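(* Let $\mathbb{K}=\mathbb{R}$ or $\mathbb{C}$, let $X=Mat_{m\times n}(\mathbb{K})$ be the space of $m\times n$ matrices and let $V\subset X$ be a $\mathbb{K}$-linear subspace. For each $s$ let $X_s=\{A\in X:\operatorname{rank}(A)=s\}$. Assume that $V$ intersects $X_s$ transversely for all $s\neq 0$. Then, for every $r$, the set $Y:=V\cap\overline{X_r}$ is Lipschitz normally embedded.
   Context: $Mat_{m\times n}(\mathbb{K})\cong\mathbb{K}^{mn}$ carries the Euclidean metric. $\overline{X_r}$ is the closure of $X_r$, i.e. the set of matrices of rank at most $r$. $V$ intersects $X_s$ transversely means $V+T_AX_s=Mat_{m\times n}(\mathbb{K})$ for all $A\in V\cap X_s$. For a subset $Y$ of a Euclidean space, $d_{out}(x,y)=\|x-y\|$ and $d_{in}^{Y}(x,y)$ is the infimum of Euclidean lengths of rectifiable paths in $Y$ joining $x$ to $y$ (it is $+\infty$ if there is none). $Y$ is Lipschitz normally embedded if there exists $K\ge 1$ such that $d_{in}^{Y}(x,y)\le K\,d_{out}(x,y)$ for all $x,y\in Y$. *)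

theory Defs
  imports "HOL-Analysis.Analysis" "HOL-Library.Set_Algebras"
begin

(* An m x n matrix over the field 'k has type 'k^'n^'m.  For 'k = real or complex the library
   norm on this type is the Frobenius norm, i.e. the Euclidean norm on K^(mn). *)

(* Scalars are taken from the entry field itself: the library's scaleR only provides real
   scalars, which would not suffice for complex subspaces. *)
definition mat_scale :: "'k::field \<Rightarrow> 'k^'n^'m \<Rightarrow> 'k^'n^'m"
  where "mat_scale c A = (\<chi> i j. c * A $ i $ j)"

interpretation mat_space: vector_space mat_scale
  by unfold_locales (simp_all add: mat_scale_def vec_eq_iff algebra_simps)

definition rank_stratum :: "nat \<Rightarrow> ('k::field^'n^'m) set"
  where "rank_stratum s = {A. rank A = s}"

(* Velocities at a of C^1 curves in S through a; for an embedded submanifold S this is the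
   usual tangent space T_a S.  For a complex submanifold it is the underlying real vector
   space of the holomorphic tangent space. *)
definition tangent_space :: "'a::real_normed_vector set \<Rightarrow> 'a \<Rightarrow> 'a set"
  where "tangent_space S a =
    {v. \<exists>\<epsilon>>0. \<exists>\<gamma>. \<gamma> C1_differentiable_on {-\<epsilon><..<\<epsilon>} \<and> \<gamma> ` {-\<epsilon><..<\<epsilon>} \<subseteq> S \<and>
          \<gamma> 0 = a \<and> (\<gamma> has_vector_derivative v) (at 0)}"

(* V is meant to be a linear subspace, so that it is its own tangent space at every point;
   the sum is the elementwise sum of sets. *)
definition transverse :: "'a::real_normed_vector set \<Rightarrow> 'a set \<Rightarrow> bool"
  where "transverse V S \<longleftrightarrow> (\<forall>A \<in> V \<inter> S. V + tangent_space S A = UNIV)"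

definition path_length :: "(real \<Rightarrow> 'a::metric_space) \<Rightarrow> ennreal"
  where "path_length g =
    (SUP (N, t) \<in> {(N::nat, t::nat \<Rightarrow> real). mono_on {..N} t \<and> t 0 = 0 \<and> t N = 1}.
       ennreal (\<Sum>i<N. dist (g (t i)) (g (t (Suc i)))))"

(* The infimum of the empty set in ennreal is infinity. *)
definition inner_dist :: "'a::metric_space set \<Rightarrow> 'a \<Rightarrow> 'a \<Rightarrow> ennreal"
  where "inner_dist Y x y =
    (INF g \<in> {g. path g \<and> path_image g \<subseteq> Y \<and> pathstart g = x \<and> pathfinish g = y \<and>
                  path_length g < \<infinity>}. path_length g)"

definition lipschitz_normally_embedded :: "'a::metric_space set \<Rightarrow> bool"
  where "lipschitz_normally_embedded Y \<longleftrightarrow>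
    (\<exists>K\<ge>1. \<forall>x\<in>Y. \<forall>y\<in>Y. inner_dist Y x y \<le> ennreal (K * dist x y))"

end

theory Submission
  imports Defs
begin

text \<open>
  Let \<open>p\<close> be a nonzero point of \<open>V\<close> of rank \<open>s\<close>. A matrix \<open>p + E\<close> near \<open>p\<close> has rank
  \<open>s + rank (D E - q E)\<close>, where \<open>D\<close> is the linear projection onto the matrices vanishing on a
  complement of \<open>ker p\<close> and taking values in a complement of \<open>range p\<close>, and \<open>D E - q E\<close> is a Schur
  complement, so that \<open>q\<close> is quadratically small. Transversality says that \<open>D\<close> maps \<open>V\<close> onto
  the whole range of \<open>D\<close>; if \<open>L\<close> is a linear right inverse with values in \<open>V\<close>, then
  \<open>E \<mapsto> E - L (q E)\<close> is a bi-Lipschitz chart of \<open>V\<close> which turns \<open>V \<inter> {rank \<le> r}\<close> into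
  \<open>{v \<in> V. rank (D v) \<le> r - s}\<close>. There two points are joined by two short segments, as for the
  variety of all matrices of bounded rank. Hence the set is locally Lipschitz normally embedded away
  from \<open>0\<close>, and since it is a closed cone, compactness of the unit sphere makes the bound global.
\<close>

section \<open>Rank over an arbitrary field\<close>

text \<open>Expanding the columns in a basis \<open>B\<close> of the column space writes every row
  as a combination of \<open>card B\<close> coefficient vectors. Since \<open>rank\<close> is
  defined through rows, this inequality and its transpose identify it with the column rank over
  every field.\<close>

lemma vec_dim_rows_le_columns:
  fixes A :: "'a::field^'n^'m"
  shows "vec.dim (rows A) \<le> vec.dim (columns A)"
proof -
  obtain B where B: "B \<subseteq> columns A" "vec.independent B" "columns A \<subseteq> vec.span B"
      "card B = vec.dim (columns A)"
    by (rule vec.basis_exists)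
  have fin: "finite B"
    using B(2) vec.finiteI_independent by blast
  have "\<exists>u. column j A = (\<Sum>b\<in>B. u b *s b)" for j
  proof -
    have "column j A \<in> vec.span B"
      using B(3) by (auto simp: columns_def)
    then show ?thesis
      by (auto simp: vec.span_finite[OF fin])
  qed
  then obtain u where u: "\<And>j. column j A = (\<Sum>b\<in>B. u j b *s b)"
    by metis
  define a where "a = (\<lambda>b. (\<chi> j. u j b) :: 'a^'n)"
  have "row i A = (\<Sum>b\<in>B. (b $ i) *s a b)" for i
  proof -
    have "A $ i $ j = (\<Sum>b\<in>B. b $ i * u j b)" for j
    proof -
      have "A $ i $ j = column j A $ i"
        by (simp add: column_def)
      then show ?thesis
        unfolding u by (simp add: mult.commute)
    qed
    then show ?thesis
      by (simp add: row_def vec_eq_iff a_def)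
  qed
  then have "rows A \<subseteq> vec.span (a ` B)"
    by (auto simp: rows_def intro!: vec.span_sum vec.span_scale intro: vec.span_base)
  then have "vec.dim (rows A) \<le> card (a ` B)"
    using fin by (intro vec.dim_le_card) auto
  also have "\<dots> \<le> card B"
    using fin by (rule card_image_le)
  finally show ?thesis
    using B(4) by simp
qed

lemma rank_eq_vec_dim_columns:
  fixes A :: "'a::field^'n^'m"
  shows "rank A = vec.dim (columns A)"
  using vec_dim_rows_le_columns[of A] vec_dim_rows_le_columns[of "transpose A"]
  by (simp add: row_rank_def_gen)

lemma span_columns_eq_range:
  fixes A :: "'a::field^'n^'m"
  shows "vec.span (columns A) = range ((*v) A)"
proof
  have "columns A \<subseteq> range ((*v) A)"
  proof
    fix x assume "x \<in> columns A"
    then obtain j where "x = column j A"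
      by (auto simp: columns_def)
    then have "x = A *v axis j 1"
      by (simp add: matrix_vector_mult_def column_def axis_def vec_eq_iff if_distrib cong: if_cong)
    then show "x \<in> range ((*v) A)"
      by blast
  qed
  moreover have "vec.subspace (range ((*v) A))"
    by (simp add: vec.subspace_image)
  ultimately show "vec.span (columns A) \<subseteq> range ((*v) A)"
    by (rule vec.span_minimal)
  show "range ((*v) A) \<subseteq> vec.span (columns A)"
  proof safe
    fix x
    have "A *v x = (\<Sum>i\<in>UNIV. x $ i *s column i A)"
      by (simp add: matrix_vector_column column_def transpose_def)
    also have "\<dots> \<in> vec.span (columns A)"
      by (intro vec.span_sum vec.span_scale vec.span_base) (auto simp: columns_def)
    finally show "A *v x \<in> vec.span (columns A)" .
  qed
qed

lemma rank_eq_vec_dim_range: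
  fixes A :: "'a::field^'n^'m"
  shows "rank A = vec.dim (range ((*v) A))"
  by (metis rank_eq_vec_dim_columns span_columns_eq_range vec.dim_span)

lemma rank_matrix_mult_le_left:
  fixes A :: "'a::field^'n^'m" and B :: "'a^'p^'n"
  shows "rank (A ** B) \<le> rank A"
  unfolding rank_eq_vec_dim_range
  by (rule vec.dim_subset) (auto simp flip: matrix_vector_mul_assoc)

lemma rank_matrix_mult_le_right:
  fixes A :: "'a::field^'n^'m" and B :: "'a^'p^'n"
  shows "rank (A ** B) \<le> rank B"
proof -
  have "range ((*v) (A ** B)) = (*v) A ` range ((*v) B)"
    by (auto simp flip: matrix_vector_mul_assoc)
  then show ?thesis
    unfolding rank_eq_vec_dim_range by (simp add: vec.dim_image_le)
qed

lemma rank_eq_0_iff: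
  fixes A :: "'a::field^'n^'m"
  shows "rank A = 0 \<longleftrightarrow> A = 0"
  unfolding rank_eq_vec_dim_range by (auto simp: matrix_eq)

lemma rank_le_CARD:
  fixes A :: "'a::field^'n^'m"
  shows "rank A \<le> CARD('m)" "rank A \<le> CARD('n)"
  by (simp add: rank_eq_vec_dim_columns dim_subset_UNIV_cart_gen)
    (simp add: row_rank_def_gen dim_subset_UNIV_cart_gen)

lemma rank_mat_1: "rank (mat 1 :: 'a::field^'n^'n) = CARD('n)"
proof -
  have "range ((*v) (mat 1 :: 'a^'n^'n)) = UNIV"
    by auto
  then show ?thesis
    using vec_dim_card by (metis rank_eq_vec_dim_range)
qed

section \<open>Generalized inverses and additivity of rank\<close>

lemma generalized_inverse_exists:
  fixes A :: "'a::field^'n^'m"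
  obtains G :: "'a^'m^'n" where "A ** G ** A = A" "G ** A ** G = G"
proof -
  obtain h where h: "Vector_Spaces.linear (*s) (*s) h" "\<forall>v\<in>range ((*v) A). A *v h v = v"
    using vec.linear_exists_right_inverse_on[OF matrix_vector_mul_linear_gen vec.subspace_UNIV]
    by blast
  define H where "H = matrix h"
  have H: "H *v x = h x" for x
    unfolding H_def using h(1) by (rule matrix_works)
  have *: "A ** H ** A = A"
    using h(2) by (simp add: matrix_eq H flip: matrix_vector_mul_assoc)
  show ?thesis
  \<comment> \<open>\<open>H\<close> inverts \<open>A\<close> on its range, which gives only the
    first identity; passing to \<open>H ** A ** H\<close> adds the second.\<close>
  proof (rule that[of "H ** A ** H"])
    show "A ** (H ** A ** H) ** A = A"
      by (metis * matrix_mul_assoc)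
    show "H ** A ** H ** A ** (H ** A ** H) = H ** A ** H"
      by (metis * matrix_mul_assoc)
  qed
qed

text \<open>Every \<open>x\<close> differs from \<open>G *v (B *v x)\<close> by an element of the
  kernel of \<open>B\<close>, so \<open>A\<close> factors through \<open>B\<close>.\<close>

lemma rank_le_of_ker_subset:
  fixes A :: "'a::field^'n^'m" and B :: "'a^'n^'p"
  assumes "\<And>x. B *v x = 0 \<Longrightarrow> A *v x = 0"
  shows "rank A \<le> rank B"
proof -
  obtain G where G: "B ** G ** B = B"
    by (rule generalized_inverse_exists)
  have "A *v x = (A ** (G ** B)) *v x" for x
  proof -
    have "B *v (x - G *v (B *v x)) = 0"
      using G by (simp add: matrix_vector_mult_diff_distrib matrix_vector_mul_assoc matrix_mul_assoc)
    then have "A *v (x - G *v (B *v x)) = 0"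
      by (rule assms)
    then show ?thesis
      by (simp add: matrix_vector_mult_diff_distrib flip: matrix_vector_mul_assoc)
  qed
  then have "A = (A ** G) ** B"
    by (simp add: matrix_eq matrix_mul_assoc)
  then show ?thesis
    using rank_matrix_mult_le_right by metis
qed

text \<open>\<open>A ** G\<close> fixes the range of \<open>A\<close> while \<open>G\<close> kills
  the range of \<open>N\<close>, so the two ranges meet only in 0; the range of the sum is their
  direct sum.\<close>

lemma rank_add_complementary:
  fixes A N :: "'a::field^'n^'m" and G :: "'a^'m^'n"
  assumes A: "A ** G ** A = A" and GN: "G ** N = 0" and NG: "N ** G = 0"
  shows "rank (A + N) = rank A + rank N"
proof -
  have AGA: "A *v (G *v (A *v x)) = A *v x" for x
    using A by (simp add: matrix_vector_mul_assoc matrix_mul_assoc)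
  have GNx: "G *v (N *v x) = 0" and NGx: "N *v (G *v y) = 0" for x y
    using GN NG by (simp_all add: matrix_vector_mul_assoc)
  have "range ((*v) (A + N)) = {x + y |x y. x \<in> range ((*v) A) \<and> y \<in> range ((*v) N)}"
  proof safe
    fix x
    show "\<exists>a b. (A + N) *v x = a + b \<and> a \<in> range ((*v) A) \<and> b \<in> range ((*v) N)"
      by (auto simp: matrix_vector_mult_add_rdistrib)
  next
    fix a b
    \<comment> \<open>The first summand is sent to \<open>A *v a\<close> by \<open>A\<close> and to
      0 by \<open>N\<close>; the second lies in the kernel of \<open>A\<close> and is sent to
      \<open>N *v b\<close> by \<open>N\<close>.\<close>
    define z where "z = G *v (A *v a) + (b - G *v (A *v b))"
    have "(A + N) *v z = A *v a + N *v b"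
      by (simp add: z_def algebra_simps AGA NGx)
    then show "A *v a + N *v b \<in> range ((*v) (A + N))"
      by (metis rangeI)
  qed
  moreover have "range ((*v) A) \<inter> range ((*v) N) = {0}"
  proof -
    have "A *v a = 0" if "A *v a = N *v b" for a b
      using AGA[of a] GNx[of b] that by simp
    moreover have "0 \<in> range ((*v) A)" "0 \<in> range ((*v) N)"
      by (metis matrix_vector_mult_0_right rangeI)+
    ultimately show ?thesis
      by auto
  qed
  ultimately show ?thesis
    using vec.dim_sums_Int[of "range ((*v) A)" "range ((*v) N)"]
    by (simp add: rank_eq_vec_dim_range vec.subspace_image)
qed

lemma rank_eq_of_invertible:
  fixes A :: "'a::field^'n^'m"
  assumes "L' ** L = mat 1" "R ** R' = mat 1"
  shows "rank (L ** A ** R) = rank A"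
proof (rule antisym)
  show "rank (L ** A ** R) \<le> rank A"
    by (meson rank_matrix_mult_le_left rank_matrix_mult_le_right order_trans)
  have "A = L' ** (L ** A ** R) ** R'"
    by (metis assms matrix_mul_assoc matrix_mul_lid matrix_mul_rid)
  then show "rank A \<le> rank (L ** A ** R)"
    by (metis rank_matrix_mult_le_left rank_matrix_mult_le_right order_trans)
qed

section \<open>Matrix multiplication and the Frobenius norm\<close>

text \<open>Cauchy-Schwarz bounds each entry of the product by a row norm times a column norm; the
  squares are then summed.\<close>

lemma norm_matrix_mult_le:
  fixes A :: "'k::real_normed_field^'n^'m" and B :: "'k^'p^'n"
  shows "norm (A ** B) \<le> norm A * norm B"
proof -
  have sq: "(norm A)\<^sup>2 = (\<Sum>i\<in>UNIV. \<Sum>k\<in>UNIV. (norm (A $ i $ k))\<^sup>2)" for A :: "'k^'x^'y"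
    by (simp add: norm_vec_def L2_set_def sum_nonneg)
  have "(norm ((A ** B) $ i $ j))\<^sup>2 \<le>
      (\<Sum>k\<in>UNIV. (norm (A $ i $ k))\<^sup>2) * (\<Sum>k\<in>UNIV. (norm (B $ k $ j))\<^sup>2)" for i j
  proof -
    have "norm ((A ** B) $ i $ j) \<le> (\<Sum>k\<in>UNIV. norm (A $ i $ k) * norm (B $ k $ j))"
      unfolding matrix_matrix_mult_def by (simp add: norm_mult sum_norm_le)
    also have "\<dots> \<le> L2_set (\<lambda>k. norm (A $ i $ k)) UNIV * L2_set (\<lambda>k. norm (B $ k $ j)) UNIV"
      using L2_set_mult_ineq[of "\<lambda>k. norm (A $ i $ k)" "\<lambda>k. norm (B $ k $ j)" UNIV] by simp
    finally have "(norm ((A ** B) $ i $ j))\<^sup>2 \<le>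
      (L2_set (\<lambda>k. norm (A $ i $ k)) UNIV * L2_set (\<lambda>k. norm (B $ k $ j)) UNIV)\<^sup>2"
      by (rule power_mono) simp
    then show ?thesis
      by (simp add: power_mult_distrib L2_set_def sum_nonneg)
  qed
  then have "(norm (A ** B))\<^sup>2 \<le> (\<Sum>i\<in>UNIV. \<Sum>j\<in>UNIV.
      (\<Sum>k\<in>UNIV. (norm (A $ i $ k))\<^sup>2) * (\<Sum>k\<in>UNIV. (norm (B $ k $ j))\<^sup>2))"
    unfolding sq by (intro sum_mono) auto
  also have "\<dots> = (\<Sum>i\<in>UNIV. \<Sum>k\<in>UNIV. (norm (A $ i $ k))\<^sup>2) *
      (\<Sum>j\<in>UNIV. \<Sum>k\<in>UNIV. (norm (B $ k $ j))\<^sup>2)"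
    by (simp add: sum_product)
  also have "(\<Sum>j\<in>UNIV. \<Sum>k\<in>UNIV. (norm (B $ k $ j))\<^sup>2) =
      (\<Sum>k\<in>UNIV. \<Sum>j\<in>UNIV. (norm (B $ k $ j))\<^sup>2)"
    by (rule sum.swap)
  finally have "(norm (A ** B))\<^sup>2 \<le> (norm A * norm B)\<^sup>2"
    by (simp add: sq power_mult_distrib)
  then show ?thesis
    by (rule power2_le_imp_le) simp
qed

lemma bounded_bilinear_matrix_mult:
  "bounded_bilinear ((**) :: 'k::real_normed_field^'n^'m \<Rightarrow> 'k^'p^'n \<Rightarrow> 'k^'p^'m)"
proof
  fix A A' :: "'k^'n^'m" and B B' :: "'k^'p^'n" and r :: real
  show "(A + A') ** B = A ** B + A' ** B"
    by (simp add: matrix_matrix_mult_def vec_eq_iff sum.distrib algebra_simps)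
  show "A ** (B + B') = A ** B + A ** B'"
    by (rule matrix_add_ldistrib)
  show "r *\<^sub>R A ** B = r *\<^sub>R (A ** B)"
    by (simp add: scalar_matrix_assoc)
  show "A ** (r *\<^sub>R B) = r *\<^sub>R (A ** B)"
    by (simp add: matrix_matrix_mult_def vec_eq_iff scaleR_sum_right)
  show "\<exists>K. \<forall>(a::'k^'n^'m) (b::'k^'p^'n). norm (a ** b) \<le> norm a * norm b * K"
    using norm_matrix_mult_le by (intro exI[of _ 1]) auto
qed

interpretation matrix_mult: bounded_bilinear
  "(**) :: 'k::real_normed_field^'n^'m \<Rightarrow> 'k^'p^'n \<Rightarrow> 'k^'p^'m"
  by (rule bounded_bilinear_matrix_mult)

lemma norm_matrix_vector_mult_le:
  fixes A :: "'k::real_normed_field^'n^'m"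
  shows "norm (A *v x) \<le> norm A * norm x"
proof -
  have "norm ((A *v x) $ i) \<le> norm (A $ i) * norm x" for i
  proof -
    have "norm ((A *v x) $ i) \<le> (\<Sum>k\<in>UNIV. norm (A $ i $ k) * norm (x $ k))"
      unfolding matrix_vector_mult_def by (simp add: norm_mult sum_norm_le)
    also have "\<dots> \<le> norm (A $ i) * norm x"
      using L2_set_mult_ineq[of "\<lambda>k. norm (A $ i $ k)" "\<lambda>k. norm (x $ k)" UNIV]
      by (simp add: norm_vec_def)
    finally show ?thesis .
  qed
  then have "L2_set (\<lambda>i. norm ((A *v x) $ i)) UNIV \<le> L2_set (\<lambda>i. norm (A $ i) * norm x) UNIV"
    by (intro L2_set_mono) auto
  then show ?thesis
    by (simp add: norm_vec_def L2_set_left_distrib)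
qed

section \<open>Schur complements\<close>

text \<open>When \<open>g\<close> is a generalized inverse of \<open>p\<close> in the sense of both
  identities above, \<open>mat 1 - g ** p\<close> projects onto the kernel of \<open>p\<close> and
  \<open>mat 1 - p ** g\<close> projects along its range. The result is the block of
  \<open>M\<close> from the kernel to a complement of the range, a model of the normal space to the
  rank stratum at \<open>p\<close>.\<close>

definition normal_part ::
    "'k::real_normed_field^'n^'m \<Rightarrow> 'k^'m^'n \<Rightarrow> 'k^'n^'m \<Rightarrow> 'k^'n^'m" where
  "normal_part p g M = (mat 1 - p ** g) ** M ** (mat 1 - g ** p)"

lemmas matrix_distribs =
  matrix_mult.add_left matrix_mult.add_right matrix_mult.diff_left matrix_mult.diff_right
  matrix_mul_assoc

lemma bounded_linear_normal_part: "bounded_linear (normal_part p g)"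
  unfolding normal_part_def
  by (intro bounded_linear_compose[OF matrix_mult.bounded_linear_left]
      bounded_linear_compose[OF matrix_mult.bounded_linear_right] bounded_linear_ident)

lemmas linear_normal_part = bounded_linear.linear[OF bounded_linear_normal_part]
lemmas normal_part_diff = linear_diff[OF linear_normal_part]
lemmas normal_part_0 = linear_0[OF linear_normal_part]
lemmas normal_part_scaleR = linear_cmul[OF linear_normal_part]

lemma normal_part_mult_0:
  assumes "p ** g ** p = p" "g ** p ** g = g"
  shows "g ** normal_part p g M = 0" "normal_part p g M ** g = 0"
proof -
  have "g ** (mat 1 - p ** g) = 0" "(mat 1 - g ** p) ** g = 0"
    using assms by (simp_all add: matrix_distribs)
  then show "g ** normal_part p g M = 0" "normal_part p g M ** g = 0"
    unfolding normal_part_def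
    by (metis matrix_mul_assoc matrix_mult.zero_left, metis matrix_mul_assoc matrix_mult.zero_right)
qed

lemma normal_part_eqI:
  assumes "g ** M = 0" "M ** g = 0"
  shows "normal_part p g M = M"
proof -
  have "p ** (g ** M) = 0" "M ** g ** p = 0"
    by (simp_all add: assms)
  then show ?thesis
    by (simp add: normal_part_def matrix_distribs)
qed

lemma normal_part_idem:
  assumes "p ** g ** p = p" "g ** p ** g = g"
  shows "normal_part p g (normal_part p g M) = normal_part p g M"
  by (simp add: normal_part_eqI normal_part_mult_0[OF assms])

text \<open>Block elimination: the invertible right factor \<open>T\<close> turns
  \<open>p + E\<close> into \<open>p + Y\<close> with \<open>g ** Y = 0\<close>, and an invertible
  left factor then removes \<open>Y ** g ** p\<close>. What is left is \<open>p\<close> plus a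
  normal part, where ranks add.\<close>

lemma rank_schur:
  fixes p E :: "'k::real_normed_field^'n^'m"
  assumes p: "p ** g ** p = p" "g ** p ** g = g"
    and T: "(mat 1 + g ** E) ** T = mat 1"
  shows "rank (p + E) = rank p + rank (normal_part p g (E ** T))"
proof -
  define Y where "Y = (mat 1 - p ** g) ** E ** T"
  define X where "X = Y ** g"
  have gY: "g ** Y = 0"
    using p by (simp add: Y_def matrix_distribs)
  have XY: "X ** Y = 0" and XX: "X ** X = 0"
    unfolding X_def using gY by (metis matrix_mul_assoc matrix_mult.zero_right matrix_mult.zero_left)+
  have "p + E = p ** (mat 1 + g ** E) + (mat 1 - p ** g) ** E"
    by (simp add: matrix_distribs)
  then have "(p + E) ** T = p ** ((mat 1 + g ** E) ** T) + Y"
    by (simp add: Y_def matrix_distribs)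
  then have PT: "(p + E) ** T = p + Y"
    by (simp add: T)
  have "(mat 1 - X) ** ((p + E) ** T) = p + Y - Y ** g ** p"
    unfolding PT using XY by (simp add: matrix_distribs X_def)
  also have "\<dots> = p + normal_part p g (E ** T)"
    by (simp add: normal_part_def Y_def matrix_distribs)
  finally have eq: "(mat 1 - X) ** (p + E) ** T = p + normal_part p g (E ** T)"
    by (simp add: matrix_mul_assoc)
  have T': "T ** (mat 1 + g ** E) = mat 1"
    using T by (simp add: matrix_left_right_inverse)
  \<comment> \<open>\<open>X\<close> squares to 0, so the left factor is invertible.\<close>
  have "(mat 1 + X) ** (mat 1 - X) = mat 1"
    using XX by (simp add: matrix_distribs)
  from rank_eq_of_invertible[OF this T', of "p + E"] eq
  have "rank (p + E) = rank (p + normal_part p g (E ** T))"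
    by simp
  then show ?thesis
    using rank_add_complementary[OF p(1) normal_part_mult_0[OF p]] by simp
qed

text \<open>A kernel vector of \<open>mat 1 + H\<close> has norm at most half of itself, so the
  matrix is injective and hence invertible. The bound follows by absorbing \<open>H ** T\<close> in
  \<open>T = mat 1 - H ** T\<close>; the identity has Frobenius norm different from 1 in general and
  so appears explicitly.\<close>

lemma matrix_inverse_near_1:
  fixes H :: "'k::real_normed_field^'n^'n"
  assumes "norm H \<le> 1/2"
  obtains T where "(mat 1 + H) ** T = mat 1" "norm T \<le> 2 * norm (mat 1 :: 'k^'n^'n)"
proof -
  have "x = 0" if "(mat 1 + H) *v x = 0" for x
  proof -
    have "x = - (H *v x)"
      using that by (simp add: matrix_vector_mult_add_rdistrib eq_neg_iff_add_eq_0)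
    then have "norm x \<le> norm H * norm x"
      using norm_matrix_vector_mult_le[of H x] by (metis norm_minus_cancel)
    also have "\<dots> \<le> 1/2 * norm x"
      using assms by (intro mult_right_mono) auto
    finally show ?thesis
      by simp
  qed
  then have "\<exists>T. T ** (mat 1 + H) = mat 1"
    by (auto simp only: matrix_left_invertible_ker)
  then obtain T where "T ** (mat 1 + H) = mat 1"
    by (rule exE)
  then have T: "(mat 1 + H) ** T = mat 1"
    by (simp add: matrix_left_right_inverse)
  then have "T = mat 1 - H ** T"
    by (simp add: matrix_distribs eq_diff_eq)
  then have "norm T = norm (mat 1 - H ** T)"
    by (rule arg_cong)
  also have "\<dots> \<le> norm (mat 1 :: 'k^'n^'n) + norm (H ** T)"
    by (rule norm_triangle_ineq4)
  also have "norm (H ** T) \<le> 1/2 * norm T"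
    using norm_matrix_mult_le[of H T] mult_right_mono[OF assms, of "norm T"] by simp
  finally show ?thesis
    using T that by simp
qed

lemma norm_matrix_mult_mono:
  fixes A :: "'k::real_normed_field^'n^'m" and B :: "'k^'p^'n"
  assumes "norm A \<le> a" "norm B \<le> b"
  shows "norm (A ** B) \<le> a * b"
proof -
  have "a \<ge> 0"
    using assms(1) norm_ge_zero[of A] by linarith
  then have "norm A * norm B \<le> a * b"
    using assms by (intro mult_mono) auto
  then show ?thesis
    using norm_matrix_mult_le[of A B] by linarith
qed

text \<open>Separates the linear part of the Schur complement from its remainder \<open>q\<close>.
  The Lipschitz constant of \<open>q\<close> on a ball is proportional to the radius, which later
  makes the correction of the chart a contraction.\<close>

lemma rank_near:
  fixes p :: "'k::real_normed_field^'n^'m"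
  assumes p: "p ** g ** p = p" "g ** p ** g = g"
  obtains q :: "'k^'n^'m \<Rightarrow> 'k^'n^'m" and C \<delta> where
    "\<delta> > 0" "C \<ge> 0" "q 0 = 0"
    "\<And>E. norm E \<le> \<delta> \<Longrightarrow> rank (p + E) = rank p + rank (normal_part p g E - q E)"
    "\<And>E. normal_part p g (q E) = q E"
    "\<And>E E' \<rho>. norm E \<le> \<rho> \<Longrightarrow> norm E' \<le> \<rho> \<Longrightarrow> \<rho> \<le> \<delta> \<Longrightarrow>
       norm (q E - q E') \<le> C * \<rho> * norm (E - E')"
proof -
  \<comment> \<open>This radius forces \<open>norm (g ** E)\<close> to be at most 1/2, so that
    \<open>mat 1 + g ** E\<close> is invertible with a uniform bound.\<close>
  define \<delta> where "\<delta> = 1 / (2 * (norm g + 1))"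
  define \<tau> where "\<tau> = 2 * norm (mat 1 :: 'k^'n^'n)"
  have \<tau>: "\<tau> \<ge> 0" and \<delta>: "\<delta> > 0"
    by (simp_all add: \<tau>_def \<delta>_def add_nonneg_pos)
  have "\<exists>T. norm E \<le> \<delta> \<longrightarrow> (mat 1 + g ** E) ** T = mat 1 \<and> norm T \<le> \<tau>" for E :: "'k^'n^'m"
  proof (cases "norm E \<le> \<delta>")
    case True
    have "norm (g ** E) \<le> norm g * \<delta>"
      using True by (intro norm_matrix_mult_mono) auto
    also have "\<dots> \<le> 1/2"
      by (simp add: \<delta>_def divide_le_eq add_nonneg_pos)
    finally show ?thesis
      unfolding \<tau>_def by (metis matrix_inverse_near_1)
  qed auto
  then obtain T where T: "\<And>E. norm E \<le> \<delta> \<Longrightarrow> (mat 1 + g ** E) ** T E = mat 1"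
      and T\<tau>: "\<And>E. norm E \<le> \<delta> \<Longrightarrow> norm (T E) \<le> \<tau>"
    by metis
  obtain K where K: "K \<ge> 0" "\<And>M. norm (normal_part p g M) \<le> norm M * K"
    using bounded_linear.nonneg_bounded[OF bounded_linear_normal_part] by blast
  \<comment> \<open>From \<open>E ** T E = E - E ** g ** E ** T E\<close>. Beyond the radius
    \<open>T E\<close> is arbitrary, but \<open>q E\<close> is still a normal part there.\<close>
  define q where "q = (\<lambda>E. normal_part p g (E ** g ** E ** T E))"
  define C where "C = (2 * norm g * \<tau> + \<delta> * norm g * norm g * \<tau> * \<tau>) * K"
  have rank: "rank (p + E) = rank p + rank (normal_part p g E - q E)" if "norm E \<le> \<delta>" for E
  proof -
    have "T E = mat 1 - g ** E ** T E"
      using T[OF that] by (simp add: matrix_distribs eq_diff_eq)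
    then have "E ** T E = E ** (mat 1 - g ** E ** T E)"
      by (rule arg_cong)
    then have "E ** T E = E - E ** g ** E ** T E"
      by (simp add: matrix_distribs)
    then show ?thesis
      unfolding rank_schur[OF p T[OF that]] q_def by (metis normal_part_diff)
  qed
  have lip: "norm (q E - q E') \<le> C * \<rho> * norm (E - E')"
    if E: "norm E \<le> \<rho>" and E': "norm E' \<le> \<rho>" and \<rho>: "\<rho> \<le> \<delta>" for E E' \<rho>
  proof -
    have \<rho>0: "\<rho> \<ge> 0"
      using E norm_ge_zero order_trans by blast
    define d where "d = norm (E - E')"
    have TE: "norm (T E) \<le> \<tau>" "norm (T E') \<le> \<tau>" and
      TI: "(mat 1 + g ** E) ** T E = mat 1" "T E' ** (mat 1 + g ** E') = mat 1"
      using E E' \<rho> T\<tau> T by (auto simp: matrix_left_right_inverse)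
    \<comment> \<open>The resolvent identity, which makes \<open>T\<close> Lipschitz.\<close>
    have "T E - T E' = T E' ** ((mat 1 + g ** E') - (mat 1 + g ** E)) ** T E"
      using TI by (simp only: matrix_mult.diff_left matrix_mult.diff_right flip: matrix_mul_assoc)
        (simp only: matrix_mul_assoc TI matrix_mul_lid matrix_mul_rid)
    then have Teq: "T E - T E' = T E' ** g ** (E' - E) ** T E"
      by (simp add: matrix_distribs)
    have d': "norm (E' - E) \<le> d" and d'': "norm (E - E') \<le> d" 
      by (simp_all add: d_def norm_minus_commute)
    note mm = norm_matrix_mult_mono
    have dT: "norm (T E - T E') \<le> \<tau> * norm g * d * \<tau>"
      unfolding Teq by (intro mm TE d' order_refl)
    \<comment> \<open>Changing one factor at a time leaves three terms, each with one difference and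
      at least one further factor of size \<open>\<rho>\<close>.\<close>
    have "E ** g ** E ** T E - E' ** g ** E' ** T E' =
      (E - E') ** g ** E ** T E + E' ** g ** (E - E') ** T E + E' ** g ** E' ** (T E - T E')"
      by (simp add: matrix_distribs)
    also have "norm \<dots> \<le> d * norm g * \<rho> * \<tau> + \<rho> * norm g * d * \<tau>
        + \<rho> * norm g * \<rho> * (\<tau> * norm g * d * \<tau>)"
      by (intro norm_triangle_mono mm TE d'' E E' dT order_refl)
    also have "\<dots> = (2 * norm g * \<tau> + \<rho> * norm g * norm g * \<tau> * \<tau>) * \<rho> * d"
      by (simp add: algebra_simps)
    also have "\<dots> \<le> (2 * norm g * \<tau> + \<delta> * norm g * norm g * \<tau> * \<tau>) * \<rho> * d"
      using \<rho> \<rho>0 \<tau> by (intro mult_right_mono add_left_mono) (auto simp: d_def)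
    finally have "norm (E ** g ** E ** T E - E' ** g ** E' ** T E') * K \<le>
        (2 * norm g * \<tau> + \<delta> * norm g * norm g * \<tau> * \<tau>) * \<rho> * d * K"
      using K(1) by (rule mult_right_mono)
    also have "\<dots> = C * \<rho> * d"
      by (simp add: C_def mult_ac)
    finally have "norm (E ** g ** E ** T E - E' ** g ** E' ** T E') * K \<le> C * \<rho> * d" .
    then show ?thesis
      using K(2)[of "E ** g ** E ** T E - E' ** g ** E' ** T E'"]
      by (simp add: q_def normal_part_diff d_def)
  qed
  show ?thesis
  proof (rule that[of \<delta> C q])
    show "C \<ge> 0"
      using K(1) \<tau> \<delta> by (simp add: C_def)
    show "q 0 = 0"
      by (simp add: q_def normal_part_0)
    show "normal_part p g (q E) = q E" for E
      unfolding q_def by (rule normal_part_idem[OF p])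
  qed (fact \<delta> rank lip)+
qed

section \<open>The closure of a rank stratum\<close>

text \<open>Near \<open>p\<close> the rank is \<open>rank p\<close> plus the rank of a Schur
  complement.\<close>

lemma rank_lower_semicontinuous:
  fixes p :: "'k::real_normed_field^'n^'m"
  obtains \<delta> where "\<delta> > 0" "\<And>M. dist M p \<le> \<delta> \<Longrightarrow> rank p \<le> rank M"
proof -
  obtain g where g: "p ** g ** p = p" "g ** p ** g = g"
    by (rule generalized_inverse_exists)
  obtain q C \<delta> where d: "(\<delta>::real) > 0"
    and r: "\<And>E. norm E \<le> \<delta> \<Longrightarrow> rank (p + E) = rank p + rank (normal_part p g E - q E)"
    by (rule rank_near[OF g]) blast
  show ?thesis
  proof (rule that[OF d])
    show "rank p \<le> rank M" if "dist M p \<le> \<delta>" for M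
      using r[of "M - p"] that by (simp add: dist_norm)
  qed
qed

lemma closed_rank_le: "closed {M :: 'k::real_normed_field^'n^'m. rank M \<le> r}"
proof -
  have "\<exists>e>0. ball p e \<subseteq> - {M. rank M \<le> r}" if "p \<in> - {M. rank M \<le> r}" for p :: "'k^'n^'m"
  proof -
    obtain \<delta> where "\<delta> > 0" "\<And>M. dist M p \<le> \<delta> \<Longrightarrow> rank p \<le> rank M"
      using rank_lower_semicontinuous[of p] by blast
    moreover have "rank p > r"
      using that by simp
    ultimately show ?thesis
      by (intro exI[of _ \<delta>] conjI subsetI)
        (auto simp: dist_commute not_le intro: order_less_le_trans)
  qed
  then show ?thesis
    unfolding closed_def open_contains_ball by blast
qed

text \<open>Without full rank both complementary projections are nonzero. A matrix unit at a nonzero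
  column of one and a nonzero row of the other has a nonzero normal part of rank one, and its rank
  adds to that of \<open>p\<close>.\<close>

lemma rank_one_perturbation:
  fixes p :: "'k::real_normed_field^'n^'m"
  assumes "rank p < CARD('m)" "rank p < CARD('n)"
  obtains N where "\<And>t. t \<noteq> 0 \<Longrightarrow> rank (p + t *\<^sub>R N) = Suc (rank p)"
proof -
  obtain g where g: "p ** g ** p = p" "g ** p ** g = g"
    by (rule generalized_inverse_exists)
  have "mat 1 - p ** g \<noteq> 0"
    using rank_matrix_mult_le_left[of p g] assms(1) rank_mat_1[where 'a='k and 'n='m] by auto
  then obtain a i where ai: "(mat 1 - p ** g) $ a $ i \<noteq> 0"
    by (auto simp: vec_eq_iff)
  have "mat 1 - g ** p \<noteq> 0"
    using rank_matrix_mult_le_right[of g p] assms(2) rank_mat_1[where 'a='k and 'n='n] by auto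
  then obtain j b where jb: "(mat 1 - g ** p) $ j $ b \<noteq> 0"
    by (auto simp: vec_eq_iff)
  define U where "U = (\<chi> x y. if x = i \<and> y = j then 1 else 0 :: 'k^'n^'m)"
  define N where "N = normal_part p g U"
  have U: "rank U \<le> 1"
  proof -
    have "range ((*v) U) \<subseteq> vec.span {axis i 1}"
    proof safe
      fix x
      have "U *v x = x $ j *s axis i 1"
        by (simp add: U_def matrix_vector_mult_def vec_eq_iff axis_def if_distrib if_distribR
            cong: if_cong)
      then show "U *v x \<in> vec.span {axis i 1}"
        by (simp add: vec.span_base vec.span_scale)
    qed
    then show ?thesis
      unfolding rank_eq_vec_dim_range using vec.dim_le_card[of "range ((*v) U)" "{axis i 1}"] by simp
  qed
  have N_entry: "N $ x $ y = (mat 1 - p ** g) $ x $ i * (mat 1 - g ** p) $ j $ y" for x y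
  proof -
    define P where "P = mat 1 - p ** g"
    define R where "R = mat 1 - g ** p"
    have "(P ** U) $ x $ z = (if z = j then P $ x $ i else 0)" for z
      by (simp add: U_def matrix_matrix_mult_def if_distrib if_distribR cong: if_cong)
    then have "(P ** U ** R) $ x $ y = (\<Sum>z\<in>UNIV. (if z = j then P $ x $ i else 0) * R $ z $ y)"
      by (simp add: matrix_matrix_mult_def[of "P ** U"])
    also have "\<dots> = P $ x $ i * R $ j $ y"
      by (simp add: if_distrib if_distribR cong: if_cong)
    finally show ?thesis
      by (simp add: N_def normal_part_def P_def R_def)
  qed
  have N0: "N \<noteq> 0"
  proof
    assume "N = 0"
    then show False
      using ai jb N_entry[of a b] by simp
  qed
  show ?thesis
  proof (rule that[of N])
    fix t :: real assume t: "t \<noteq> 0"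
    have eq: "t *\<^sub>R N = normal_part p g (t *\<^sub>R U)"
      by (simp add: N_def normal_part_scaleR)
    have "rank (t *\<^sub>R N) \<le> rank U"
    proof -
      have "t *\<^sub>R N = (t *\<^sub>R (mat 1 - p ** g)) ** U ** (mat 1 - g ** p)"
        by (simp add: N_def normal_part_def scalar_matrix_assoc)
      then show ?thesis
        by (metis rank_matrix_mult_le_left rank_matrix_mult_le_right order_trans)
    qed
    moreover have "rank (t *\<^sub>R N) \<noteq> 0"
      using t N0 by (simp add: rank_eq_0_iff)
    ultimately have "rank (t *\<^sub>R N) = 1"
      using U by linarith
    then show "rank (p + t *\<^sub>R N) = Suc (rank p)"
      using rank_add_complementary[OF g(1) normal_part_mult_0[OF g], of "t *\<^sub>R U"]
      by (simp add: eq)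
  qed
qed

text \<open>A matrix of rank below \<open>r\<close> is a limit of matrices of the next rank, and
  induction on the deficit \<open>r - rank p\<close> climbs up to \<open>r\<close>. The size bounds
  guarantee room for each step.\<close>

lemma closure_rank_stratum:
  assumes "r \<le> CARD('m)" "r \<le> CARD('n)"
  shows "closure (rank_stratum r :: ('k::real_normed_field^'n^'m) set) = {M. rank M \<le> r}"
proof
  show "closure (rank_stratum r :: ('k^'n^'m) set) \<subseteq> {M. rank M \<le> r}"
    by (rule closure_minimal) (auto simp: rank_stratum_def closed_rank_le)
  have step: "p \<in> closure (rank_stratum (Suc (rank p)))"
    if "rank p < r" for p :: "'k^'n^'m"
  proof -
    have "rank p < CARD('m)" "rank p < CARD('n)"
      using that assms by auto
    then obtain N where N: "\<And>t. t \<noteq> 0 \<Longrightarrow> rank (p + t *\<^sub>R N) = Suc (rank p)"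
      by (rule rank_one_perturbation) blast
    have "(\<lambda>n. p + inverse (real (Suc n)) *\<^sub>R N) \<longlonglongrightarrow> p + 0 *\<^sub>R N"
      by (intro tendsto_intros LIMSEQ_inverse_real_of_nat)
    moreover have "p + inverse (real (Suc n)) *\<^sub>R N \<in> rank_stratum (Suc (rank p))" for n
      by (simp add: rank_stratum_def N)
    ultimately show ?thesis
      unfolding closure_sequential by (intro exI[of _ "\<lambda>n. p + inverse (real (Suc n)) *\<^sub>R N"]) simp
  qed
  have "p \<in> closure (rank_stratum r)" if "rank p \<le> r" for p :: "'k^'n^'m"
    using that
  proof (induction "r - rank p" arbitrary: p)
    case 0
    then show ?case
      by (intro closure_subset[THEN subsetD]) (simp add: rank_stratum_def)
  next
    case (Suc d)
    have "rank_stratum (Suc (rank p)) \<subseteq> closure (rank_stratum r :: ('k^'n^'m) set)"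
      using Suc by (auto simp: rank_stratum_def)
    then have "closure (rank_stratum (Suc (rank p))) \<subseteq> closure (rank_stratum r :: ('k^'n^'m) set)"
      by (simp add: closure_minimal)
    then show ?case
      using step[of p] Suc.hyps(2) by auto
  qed
  then show "{M. rank M \<le> r} \<subseteq> closure (rank_stratum r :: ('k^'n^'m) set)"
    by blast
qed

section \<open>Lipschitz paths and inner distances\<close>

text \<open>A Lipschitz parametrization on the unit interval certifies length at most
  \<open>C\<close>. Unlike an infimum of lengths, this certificate passes directly through Lipschitz
  maps and concatenation.\<close>

definition lipschitz_joined :: "'a::metric_space set \<Rightarrow> real \<Rightarrow> 'a \<Rightarrow> 'a \<Rightarrow> bool" where
  "lipschitz_joined Y C x y \<longleftrightarrow> (\<exists>g. C-lipschitz_on {0..1::real} g \<and> g ` {0..1} \<subseteq> Y \<and> g 0 = x \<and> g 1 = y)"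

lemma lipschitz_joinedE:
  assumes "lipschitz_joined Y C x y"
  obtains g :: "real \<Rightarrow> 'a::metric_space" where
    "C-lipschitz_on {0..1} g" "g ` {0..1} \<subseteq> Y" "g 0 = x" "g 1 = y"
  using assms unfolding lipschitz_joined_def by blast

lemma path_length_le_lipschitz:
  assumes "C-lipschitz_on {0..1} g"
  shows "path_length g \<le> ennreal C"
  unfolding path_length_def
proof (rule SUP_least, clarify)
  fix N and t :: "nat \<Rightarrow> real"
  assume t: "mono_on {..N} t" "t 0 = 0" "t N = 1"
  have t01: "t i \<in> {0..1}" if "i \<le> N" for i
    using mono_onD[OF t(1), of 0 i] mono_onD[OF t(1), of i N] that t by auto
  have "(\<Sum>i<N. dist (g (t i)) (g (t (Suc i)))) \<le> (\<Sum>i<N. C * (t (Suc i) - t i))"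
  proof (rule sum_mono)
    fix i assume "i \<in> {..<N}"
    then have "t i \<le> t (Suc i)" "t i \<in> {0..1}" "t (Suc i) \<in> {0..1}"
      using mono_onD[OF t(1), of i "Suc i"] t01 by auto
    then show "dist (g (t i)) (g (t (Suc i))) \<le> C * (t (Suc i) - t i)"
      using lipschitz_onD[OF assms, of "t i" "t (Suc i)"] by (simp add: dist_real_def)
  qed
  also have "\<dots> = C"
    using sum_lessThan_telescope[of t N] t by (simp flip: sum_distrib_left)
  finally show "ennreal (\<Sum>i<N. dist (g (t i)) (g (t (Suc i)))) \<le> ennreal C"
    by (rule ennreal_leI)
qed

lemma inner_dist_le_lipschitz_joined:
  assumes "lipschitz_joined Y C x y"
  shows "inner_dist Y x y \<le> ennreal C"
proof -
  obtain g :: "real \<Rightarrow> _" where g: "C-lipschitz_on {0..1} g" "g ` {0..1} \<subseteq> Y" "g 0 = x" "g 1 = y"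
    using assms by (rule lipschitz_joinedE)
  have len: "path_length g \<le> ennreal C"
    by (rule path_length_le_lipschitz[OF g(1)])
  then have "path_length g < \<infinity>"
    by (metis ennreal_less_top infinity_ennreal_def order_le_less_trans)
  moreover have "path g"
    using g(1) by (simp add: path_def lipschitz_on_continuous_on)
  ultimately have "inner_dist Y x y \<le> path_length g"
    unfolding inner_dist_def
    using g by (intro INF_lower) (auto simp: path_image_def pathstart_def pathfinish_def)
  then show ?thesis
    using len by (rule order_trans)
qed

lemma lipschitz_joined_mono:
  assumes "lipschitz_joined Y C x y" "C \<le> D" "Y \<subseteq> Z"
  shows "lipschitz_joined Z D x y"
proof -
  obtain g :: "real \<Rightarrow> 'a" where g: "C-lipschitz_on {0..1} g" "g ` {0..1} \<subseteq> Y" "g 0 = x" "g 1 = y"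
    using assms(1) by (rule lipschitz_joinedE)
  have "D-lipschitz_on {0..1} g"
    using g(1) assms(2) by (rule lipschitz_on_mono[OF _ order_refl])
  then show ?thesis
    unfolding lipschitz_joined_def using g assms(3) by blast
qed

lemma lipschitz_joined_image:
  assumes "lipschitz_joined Y C x y" "D-lipschitz_on Y f" "f ` Y \<subseteq> Z"
  shows "lipschitz_joined Z (D * C) (f x) (f y)"
proof -
  obtain g :: "real \<Rightarrow> _" where g: "C-lipschitz_on {0..1} g" "g ` {0..1} \<subseteq> Y" "g 0 = x" "g 1 = y"
    using assms(1) by (rule lipschitz_joinedE)
  have "(D * C)-lipschitz_on {0..1} (f \<circ> g)"
    using g assms(2) by (intro lipschitz_on_compose) (auto intro: lipschitz_on_subset)
  then show ?thesis
    unfolding lipschitz_joined_def using g assms(3) by (intro exI[of _ "f \<circ> g"]) (auto simp: image_subset_iff)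
qed

lemma lipschitz_joined_sym:
  assumes "lipschitz_joined Y C x y"
  shows "lipschitz_joined Y C y x"
proof -
  obtain g :: "real \<Rightarrow> _" where g: "C-lipschitz_on {0..1} g" "g ` {0..1} \<subseteq> Y" "g 0 = x" "g 1 = y"
    using assms by (rule lipschitz_joinedE)
  have "C-lipschitz_on {0..1} (\<lambda>t. g (1 - t))"
  proof (rule lipschitz_onI)
    fix s t :: real assume "s \<in> {0..1}" "t \<in> {0..1}"
    then show "dist (g (1 - s)) (g (1 - t)) \<le> C * dist s t"
      using lipschitz_onD[OF g(1), of "1 - s" "1 - t"] by (simp add: dist_real_def abs_minus_commute)
  qed (use g(1) lipschitz_on_nonneg in blast)
  then show ?thesis
    unfolding lipschitz_joined_def using g(2-) by (intro exI[of _ "\<lambda>t. g (1 - t)"]) auto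
qed

text \<open>Running each path in half the time doubles its constant; \<open>2 * (a + b)\<close>
  dominates the maximum of the two.\<close>

lemma lipschitz_joined_trans:
  assumes "lipschitz_joined Y a x y" "lipschitz_joined Y b y z"
  shows "lipschitz_joined Y (2 * (a + b)) x z"
proof -
  obtain g :: "real \<Rightarrow> _" where g: "a-lipschitz_on {0..1} g" "g ` {0..1} \<subseteq> Y" "g 0 = x" "g 1 = y"
    using assms(1) by (rule lipschitz_joinedE)
  obtain h :: "real \<Rightarrow> _" where h: "b-lipschitz_on {0..1} h" "h ` {0..1} \<subseteq> Y" "h 0 = y" "h 1 = z"
    using assms(2) by (rule lipschitz_joinedE)
  have ab: "a \<ge> 0" "b \<ge> 0"
    using g(1) h(1) lipschitz_on_nonneg by blast+
  define f where "f = (\<lambda>t::real. if t \<le> 1/2 then g (2 * t) else h (2 * t - 1))"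
  have "(max (2 * a) (2 * b))-lipschitz_on {0..1} f"
    unfolding f_def
  proof (rule lipschitz_on_concat_max)
    show "(2 * a)-lipschitz_on {0..1/2} (\<lambda>t. g (2 * t))"
    proof (rule lipschitz_onI)
      fix s t :: real assume "s \<in> {0..1/2}" "t \<in> {0..1/2}"
      then have "dist (g (2 * s)) (g (2 * t)) \<le> a * dist (2 * s) (2 * t)"
        by (intro lipschitz_onD[OF g(1)]) auto
      also have "dist (2 * s) (2 * t) = 2 * dist s t"
        by (simp add: dist_real_def abs_if)
      finally show "dist (g (2 * s)) (g (2 * t)) \<le> 2 * a * dist s t"
        by simp
    qed (use ab in auto)
    show "(2 * b)-lipschitz_on {1/2..1} (\<lambda>t. h (2 * t - 1))"
    proof (rule lipschitz_onI)
      fix s t :: real assume "s \<in> {1/2..1}" "t \<in> {1/2..1}"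
      then have "dist (h (2 * s - 1)) (h (2 * t - 1)) \<le> b * dist (2 * s - 1) (2 * t - 1)"
        by (intro lipschitz_onD[OF h(1)]) auto
      also have "dist (2 * s - 1) (2 * t - 1) = 2 * dist s t"
        by (simp add: dist_real_def abs_if)
      finally show "dist (h (2 * s - 1)) (h (2 * t - 1)) \<le> 2 * b * dist s t"
        by simp
    qed (use ab in auto)
  qed (use g h in auto)
  then have "(2 * (a + b))-lipschitz_on {0..1} f"
    by (rule lipschitz_on_mono) (use ab in auto)
  moreover have "f ` {0..1} \<subseteq> Y"
    using g(2) h(2) by (auto simp: f_def image_subset_iff)
  ultimately show ?thesis
    unfolding lipschitz_joined_def using g(3) h(4) by (intro exI[of _ f]) (auto simp: f_def)
qed

lemma lipschitz_joined_segment: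
  fixes x y :: "'a::real_normed_vector"
  assumes "closed_segment x y \<subseteq> Y"
  shows "lipschitz_joined Y (dist x y) x y"
  unfolding lipschitz_joined_def
proof (intro exI conjI)
  show "(dist x y)-lipschitz_on {0..1} (\<lambda>t. (1 - t) *\<^sub>R x + t *\<^sub>R y)"
  proof (rule lipschitz_onI)
    fix s t :: real
    have "(1 - s) *\<^sub>R x + s *\<^sub>R y - ((1 - t) *\<^sub>R x + t *\<^sub>R y) = (s - t) *\<^sub>R (y - x)"
      by (simp add: algebra_simps)
    then show "dist ((1 - s) *\<^sub>R x + s *\<^sub>R y) ((1 - t) *\<^sub>R x + t *\<^sub>R y) \<le> dist x y * dist s t"
      by (simp add: dist_norm norm_minus_commute)
  qed auto
  show "(\<lambda>t. (1 - t) *\<^sub>R x + t *\<^sub>R y) ` {0..1} \<subseteq> Y"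
    using assms by (force simp: closed_segment_def)
qed simp_all

section \<open>From local to global bounds on closed cones\<close>

text \<open>Pairs violating ever larger constants can be rescaled so that the larger norm is 1.
  Paths through 0 serve pairs that are far apart, so the bad pairs must collapse to a point of the
  unit sphere, where the local bound contradicts their choice. The vertex 0 thus needs no local
  bound.\<close>

lemma lipschitz_normally_embedded_cone:
  fixes Y :: "'a::euclidean_space set"
  assumes "closed Y"
    and cone: "\<And>c x. c \<ge> 0 \<Longrightarrow> x \<in> Y \<Longrightarrow> c *\<^sub>R x \<in> Y"
    and loc: "\<And>p. p \<in> Y \<Longrightarrow> p \<noteq> 0 \<Longrightarrow> \<exists>\<delta>>0. \<exists>K. \<forall>x\<in>Y \<inter> cball p \<delta>. \<forall>y\<in>Y \<inter> cball p \<delta>.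
      lipschitz_joined Y (K * dist x y) x y"
  shows "lipschitz_normally_embedded Y"
proof -
  have scale: "lipschitz_joined Y (c * C) (c *\<^sub>R x) (c *\<^sub>R y)"
    if "lipschitz_joined Y C x y" "c \<ge> 0" for c C x y
  proof (rule lipschitz_joined_image[OF that(1)])
    show "c-lipschitz_on Y ((*\<^sub>R) c)"
      using that(2) by (intro lipschitz_onI) (auto simp: dist_norm simp flip: scaleR_diff_right)
  qed (use cone that(2) in auto)
  have seg0: "lipschitz_joined Y (norm x) x 0" if "x \<in> Y" for x
  proof -
    have "closed_segment x 0 \<subseteq> Y"
      using cone[OF _ that] by (auto simp: closed_segment_def)
    from lipschitz_joined_segment[OF this] show ?thesis
      by simp
  qed
  have through0: "lipschitz_joined Y (2 * (norm x + norm y)) x y" if "x \<in> Y" "y \<in> Y" for x y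
    using lipschitz_joined_trans[OF seg0 lipschitz_joined_sym[OF seg0]] that by blast
  have "\<exists>k::nat. \<forall>x\<in>Y. \<forall>y\<in>Y. lipschitz_joined Y (real (Suc k) * dist x y) x y"
  proof (rule ccontr)
    assume contra: "\<not> ?thesis"
    have "\<exists>u v. u \<in> Y \<and> v \<in> Y \<and> norm u = 1 \<and> norm v \<le> 1 \<and>
        \<not> lipschitz_joined Y (real (Suc k) * dist u v) u v" for k
    proof -
      obtain a b where ab: "a \<in> Y" "b \<in> Y" "\<not> lipschitz_joined Y (real (Suc k) * dist a b) a b"
        using contra by blast
      \<comment> \<open>By symmetry the first point may be taken to have the larger norm.\<close>
      obtain x y where xy: "x \<in> Y" "y \<in> Y" "norm y \<le> norm x"
        "\<not> lipschitz_joined Y (real (Suc k) * dist x y) x y"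
      proof (cases "norm b \<le> norm a")
        case True
        then show ?thesis
          using that ab by blast
      next
        case False
        then show ?thesis
          using that[of b a] ab lipschitz_joined_sym by (auto simp: dist_commute)
      qed
      have "x \<noteq> 0"
      proof
        assume "x = 0"
        then show False
          using xy through0[of x y] by simp
      qed
      define u where "u = inverse (norm x) *\<^sub>R x"
      define v where "v = inverse (norm x) *\<^sub>R y"
      have xu: "x = norm x *\<^sub>R u" and yv: "y = norm x *\<^sub>R v"
        using \<open>x \<noteq> 0\<close> by (simp_all add: u_def v_def)
      have "\<not> lipschitz_joined Y (real (Suc k) * dist u v) u v"
      proof
        assume "lipschitz_joined Y (real (Suc k) * dist u v) u v"
        from scale[OF this, of "norm x"]
        have "lipschitz_joined Y (norm x * (real (Suc k) * dist u v)) x y"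
          by (simp only: xu[symmetric] yv[symmetric]) simp
        moreover have "dist x y = norm x * dist u v"
        proof -
          have "x - y = norm x *\<^sub>R (u - v)"
            using xu yv by (simp only: scaleR_diff_right)
          then show ?thesis
            by (simp only: dist_norm norm_scaleR abs_norm_cancel)
        qed
        ultimately show False
          using xy(4) by (simp only: mult.left_commute not_True_eq_False)
      qed
      moreover have "u \<in> Y" "v \<in> Y"
        using cone xy by (simp_all add: u_def v_def)
      moreover have "norm u = 1" "norm v \<le> 1"
        using \<open>x \<noteq> 0\<close> xy(3) by (simp_all add: u_def v_def field_simps)
      ultimately show ?thesis
        by blast
    qed
    then obtain u v where uv: "\<And>k. u k \<in> Y" "\<And>k. v k \<in> Y" "\<And>k. norm (u k) = 1" "\<And>k. norm (v k) \<le> 1"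
        "\<And>k. \<not> lipschitz_joined Y (real (Suc k) * dist (u k) (v k)) (u k) (v k)"
      by metis
    \<comment> \<open>With both norms at most 1 the path through 0 has constant at most 4, so a bad
      pair at larger distance would be joined after all.\<close>
    have close: "dist (u k) (v k) \<le> 4 * inverse (real (Suc k))" for k
    proof (rule ccontr)
      assume "\<not> ?thesis"
      then have "2 * (norm (u k) + norm (v k)) \<le> real (Suc k) * dist (u k) (v k)"
        using uv(3)[of k] uv(4)[of k] by (simp add: field_simps)
      with lipschitz_joined_mono[OF through0[OF uv(1)[of k] uv(2)[of k]] this order_refl] uv(5)[of k]
      show False by blast
    qed
    have "compact (sphere 0 1 \<inter> Y)"
      using \<open>closed Y\<close> by (intro compact_Int_closed) auto
    moreover have "\<forall>k. u k \<in> sphere 0 1 \<inter> Y"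
      using uv by simp
    ultimately obtain p \<phi> where p: "p \<in> sphere 0 1 \<inter> Y" and \<phi>: "strict_mono (\<phi> :: nat \<Rightarrow> nat)"
      and lim: "(u \<circ> \<phi>) \<longlonglongrightarrow> p"
      unfolding compact_def by metis
    have "(\<lambda>k. dist (u k) (v k)) \<longlonglongrightarrow> 0"
    proof (rule tendsto_sandwich[OF _ _ tendsto_const])
      show "(\<lambda>k. 4 * inverse (real (Suc k))) \<longlonglongrightarrow> 0"
        using tendsto_mult_right_zero[OF LIMSEQ_inverse_real_of_nat] by simp
    qed (use close in auto)
    then have "(\<lambda>k. dist (u (\<phi> k)) (v (\<phi> k))) \<longlonglongrightarrow> 0"
      using LIMSEQ_subseq_LIMSEQ[OF _ \<phi>] by (fastforce simp: o_def)
    then have "(\<lambda>k. u (\<phi> k) - v (\<phi> k)) \<longlonglongrightarrow> 0"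
      unfolding dist_norm by (rule tendsto_norm_zero_cancel)
    from tendsto_diff[OF lim this] have lim_v: "(v \<circ> \<phi>) \<longlonglongrightarrow> p"
      by (simp add: o_def)
    from p have "p \<in> Y" "p \<noteq> 0"
      by auto
    then obtain \<delta> K where \<delta>: "\<delta> > 0"
      and K: "\<And>x y. x \<in> Y \<inter> cball p \<delta> \<Longrightarrow> y \<in> Y \<inter> cball p \<delta> \<Longrightarrow> lipschitz_joined Y (K * dist x y) x y"
      using loc by meson
    have "\<forall>\<^sub>F k in sequentially. dist (u (\<phi> k)) p < \<delta>" "\<forall>\<^sub>F k in sequentially. dist (v (\<phi> k)) p < \<delta>"
      using lim lim_v \<delta> by (auto simp: tendsto_iff o_def)
    moreover have "\<forall>\<^sub>F k in sequentially. K \<le> real k"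
      by (rule eventually_sequentiallyI[of "nat \<lceil>K\<rceil>"]) linarith
    ultimately have "\<forall>\<^sub>F k in sequentially. False"
    proof eventually_elim
      case (elim k)
      have "lipschitz_joined Y (K * dist (u (\<phi> k)) (v (\<phi> k))) (u (\<phi> k)) (v (\<phi> k))"
        using elim uv by (intro K) (auto simp: dist_commute)
      \<comment> \<open>A strictly increasing \<open>\<phi>\<close> satisfies
        \<open>k \<le> \<phi> k\<close>, so the violated constants eventually exceed the local
        one.\<close>
      moreover have "K \<le> real (Suc (\<phi> k))"
        using elim(3) seq_suble[OF \<phi>, of k] by linarith
      ultimately show False
        using uv(5)[of "\<phi> k"] lipschitz_joined_mono[OF _ _ order_refl] mult_right_mono zero_le_dist
        by metis
    qed
    then show False
      by simp
  qed
  then obtain k :: nat where k: "\<And>x y. x \<in> Y \<Longrightarrow> y \<in> Y \<Longrightarrow> lipschitz_joined Y (real (Suc k) * dist x y) x y"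
    by blast
  show ?thesis
    unfolding lipschitz_normally_embedded_def
    using k by (intro exI[of _ "real (Suc k)"]) (auto intro: inner_dist_le_lipschitz_joined)
qed

section \<open>Inverting a small perturbation of the identity\<close>

text \<open>Solving \<open>x - f x = w\<close> means finding the fixed point of
  \<open>x \<mapsto> w + f x\<close>, a contraction of the ball of radius \<open>\<rho>\<close> when
  \<open>w\<close> lies in the half-size ball. Uniqueness of the fixed point gives the last
  property.\<close>

lemma perturbed_identity_inverse:
  fixes f :: "'a::banach \<Rightarrow> 'a"
  assumes "\<rho> \<ge> 0" and f0: "f 0 = 0" and f: "(1/2)-lipschitz_on (cball 0 \<rho>) f"
  obtains \<psi> where "2-lipschitz_on (cball 0 (\<rho> / 2)) \<psi>"
    "\<And>w. w \<in> cball 0 (\<rho> / 2) \<Longrightarrow> \<psi> w \<in> cball 0 \<rho> \<and> \<psi> w - f (\<psi> w) = w"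
    "\<And>x. x \<in> cball 0 \<rho> \<Longrightarrow> x - f x \<in> cball 0 (\<rho> / 2) \<Longrightarrow> \<psi> (x - f x) = x"
proof -
  have "\<exists>!x\<in>cball 0 \<rho>. w + f x = x" if w: "w \<in> cball 0 (\<rho> / 2)" for w
  proof (rule Banach_fix[of _ "1/2"])
    show "complete (cball (0::'a) \<rho>)"
      by (simp add: complete_eq_closed)
    show "(\<lambda>x. w + f x) ` cball 0 \<rho> \<subseteq> cball 0 \<rho>"
    proof safe
      fix x :: 'a assume x: "x \<in> cball 0 \<rho>"
      have "norm (f x) \<le> 1/2 * norm x"
        using lipschitz_onD[OF f x, of 0] assms(1) f0 by simp
      then show "w + f x \<in> cball 0 \<rho>"
        using x w norm_triangle_ineq[of w "f x"] by simp
    qed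
  qed (use assms(1) lipschitz_onD[OF f] in auto)
  then obtain \<psi> where \<psi>: "\<And>w. w \<in> cball 0 (\<rho> / 2) \<Longrightarrow> \<psi> w \<in> cball 0 \<rho> \<and> w + f (\<psi> w) = \<psi> w"
    and uniq: "\<And>w x. w \<in> cball 0 (\<rho> / 2) \<Longrightarrow> x \<in> cball 0 \<rho> \<Longrightarrow> w + f x = x \<Longrightarrow> x = \<psi> w"
    by metis
  show ?thesis
  proof (rule that[of \<psi>])
    show "2-lipschitz_on (cball 0 (\<rho> / 2)) \<psi>"
    proof (rule lipschitz_onI)
      fix v w :: 'a assume vw: "v \<in> cball 0 (\<rho> / 2)" "w \<in> cball 0 (\<rho> / 2)"
      have "dist (\<psi> v) (\<psi> w) = dist (v + f (\<psi> v)) (w + f (\<psi> w))"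
        using \<psi> vw by simp
      also have "\<dots> \<le> dist v w + dist (f (\<psi> v)) (f (\<psi> w))"
        by (rule dist_triangle_add)
      also have "dist (f (\<psi> v)) (f (\<psi> w)) \<le> 1/2 * dist (\<psi> v) (\<psi> w)"
        using \<psi> vw by (intro lipschitz_onD[OF f]) auto
      finally show "dist (\<psi> v) (\<psi> w) \<le> 2 * dist v w"
        by simp
    qed simp
    show "\<psi> w \<in> cball 0 \<rho> \<and> \<psi> w - f (\<psi> w) = w" if "w \<in> cball 0 (\<rho> / 2)" for w
      using \<psi>[OF that] by (simp add: diff_eq_eq)
    show "\<psi> (x - f x) = x" if "x \<in> cball 0 \<rho>" "x - f x \<in> cball 0 (\<rho> / 2)" for x
      using uniq[OF that(2,1)] by simp
  qed
qed

section \<open>Paths of matrices of bounded rank\<close>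

text \<open>\<open>Q\<close> is the orthogonal projection for the real inner product. The assumption
  \<open>adj\<close> provides scalar adjoints, so the orthogonal complement of the kernel is closed
  under scalars of \<open>'k\<close>; hence the projection is linear over \<open>'k\<close> and
  given by a matrix. The norm bound is crude but independent of \<open>B\<close>.\<close>

lemma kernel_projection:
  fixes B :: "'k::{real_normed_field,euclidean_space}^'n^'m"
  assumes adj: "\<And>c::'k. \<exists>c'. \<forall>a b. (c * a) \<bullet> b = a \<bullet> (c' * b)"
  obtains Q :: "'k^'n^'n" where "B ** Q = 0" "\<And>x. B *v x = 0 \<Longrightarrow> Q *v x = x"
    "norm Q \<le> real CARD('n) * real CARD('n)"
proof -
  define S where "S = {x. B *v x = 0}"
  have sub: "subspace S"
    unfolding S_def by (rule linear_subspace_kernel) simp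
  then have span: "span S = S"
    by (rule span_eq_iff[THEN iffD2])
  have scale: "c *s x \<in> S" if "x \<in> S" for c x
    using that by (simp add: S_def vector_scalar_commute)
  have scale_orth: "inner (c *s z) s = 0" if "\<And>w. w \<in> S \<Longrightarrow> inner z w = 0" "s \<in> S" for c :: 'k and z s
  proof -
    obtain c' where c': "\<And>a b. (c * a) \<bullet> b = a \<bullet> (c' * b)"
      using adj by blast
    have "inner (c *s z) s = inner z (c' *s s)"
      by (simp add: inner_vec_def c')
    then show ?thesis
      using that scale by simp
  qed
  have "\<exists>y. y \<in> S \<and> (\<forall>w\<in>S. inner (x - y) w = 0)" for x
  proof -
    obtain y z where yz: "y \<in> span S" "\<And>w. w \<in> span S \<Longrightarrow> orthogonal z w" "x = y + z"
      by (rule orthogonal_subspace_decomp_exists[of S x]) blast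
    have "x - y = z"
      by (simp add: yz(3))
    then show ?thesis
      using yz(1,2) unfolding span orthogonal_def by blast
  qed
  then obtain h where hS: "\<And>x. h x \<in> S" and h_orth: "\<And>x w. w \<in> S \<Longrightarrow> inner (x - h x) w = 0"
    by metis
  \<comment> \<open>Uniqueness of the orthogonal decomposition, from which linearity of
    \<open>h\<close> is read off.\<close>
  have h_eqI: "h x = y" if "y \<in> S" "\<And>w. w \<in> S \<Longrightarrow> inner (x - y) w = 0" for x y
  proof -
    have d: "h x - y \<in> S"
      using sub hS that by (intro subspace_diff)
    have "inner (h x - y) (h x - y) = inner (x - y) (h x - y) - inner (x - h x) (h x - y)"
      by (simp flip: inner_diff_left)
    also have "\<dots> = 0"
      using that(2)[OF d] h_orth[OF d] by simp
    finally show ?thesis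
      by simp
  qed
  have lin: "Vector_Spaces.linear (*s) (*s) h"
  proof (unfold_locales)
    fix a b x
    show "h (a + b) = h a + h b"
    proof (rule h_eqI)
      show "inner (a + b - (h a + h b)) w = 0" if "w \<in> S" for w
        using h_orth[OF that, of a] h_orth[OF that, of b] by (simp add: inner_diff_left inner_add_left)
    qed (use sub hS in \<open>simp add: subspace_add\<close>)
    show "h (c *s x) = c *s h x" for c
    proof (rule h_eqI)
      show "inner (c *s x - c *s h x) w = 0" if "w \<in> S" for w
        using scale_orth[of "x - h x" w c] h_orth that by (simp add: vec.scale_right_diff_distrib)
    qed (use scale hS in simp)
  qed
  define Q where "Q = matrix h"
  have Q: "Q *v x = h x" for x
    unfolding Q_def using lin by (rule matrix_works)
  have nh: "norm (h x) \<le> norm x" for x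
  proof -
    have "inner (h x) (h x) = inner x (h x)"
      using h_orth[OF hS, of x x] by (simp add: inner_diff_left)
    also have "\<dots> \<le> norm x * norm (h x)"
      by (rule norm_cauchy_schwarz)
    finally have "norm (h x) * norm (h x) \<le> norm x * norm (h x)"
      by (simp add: dot_square_norm power2_eq_square)
    then show ?thesis
      using mult_right_le_imp_le[of "norm (h x)" "norm (h x)" "norm x"]
      by (cases "h x = 0") auto
  qed
  \<comment> \<open>Each entry is a coordinate of the image of a unit vector under a map that does
    not increase norms.\<close>
  have entry: "norm (Q $ i $ j) \<le> 1" for i j
  proof -
    have "Q $ i $ j = h (axis j 1) $ i"
      by (simp add: Q_def matrix_def)
    moreover have "norm (axis j 1 :: 'k^'n) = 1"
    proof -
      have "norm (axis j 1 :: 'k^'n) = norm (axis j (norm (1::'k)))"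
        by (simp add: norm_vec_def axis_def if_distrib[of norm] cong: if_cong)
      then show ?thesis
        by simp
    qed
    ultimately show ?thesis
      using Finite_Cartesian_Product.norm_nth_le[of "h (axis j 1)" i] nh[of "axis j 1"] by simp
  qed
  show ?thesis
  proof (rule that[of Q])
    show "B ** Q = 0"
      using hS by (simp add: matrix_eq S_def Q flip: matrix_vector_mul_assoc)
    show "Q *v x = x" if "B *v x = 0" for x
      using that by (simp add: Q S_def h_eqI)
    have "norm Q \<le> (\<Sum>i\<in>UNIV. norm (Q $ i))"
      by (simp add: norm_vec_def[of Q] L2_set_le_sum)
    also have "\<dots> \<le> (\<Sum>i\<in>UNIV. \<Sum>j\<in>UNIV. norm (Q $ i $ j))"
      by (intro sum_mono) (simp add: norm_vec_def[of "Q $ _"] L2_set_le_sum)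
    also have "\<dots> \<le> (\<Sum>i\<in>(UNIV::'n set). \<Sum>j\<in>(UNIV::'n set). 1)"
      by (intro sum_mono entry)
    finally show "norm Q \<le> real CARD('n) * real CARD('n)"
      by simp
  qed
qed

text \<open>
  Two matrices \<open>A\<close> and \<open>B\<close> of rank at most \<open>k\<close> are joined by going straight from \<open>A\<close> to
  \<open>A (1 - Q)\<close> and from there straight to \<open>B\<close>, where \<open>Q\<close> is the orthogonal projection onto the
  kernel of \<open>B\<close>: the first segment consists of right multiples of \<open>A\<close>, the second one of matrices that
  vanish on the kernel of \<open>B\<close>. Both segments are short because \<open>A Q = (A - B) Q\<close>.
\<close>

lemma bounded_rank_normal_part_joined:
  fixes p :: "'k::{real_normed_field,euclidean_space}^'n^'m"
  assumes adj: "\<And>c::'k. \<exists>c'. \<forall>a b. (c * a) \<bullet> b = a \<bullet> (c' * b)"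
    and p: "p ** g ** p = p" "g ** p ** g = g"
    and V: "subspace V" and L: "bounded_linear L" "\<And>M. L M \<in> V"
    and DL: "\<And>M. normal_part p g (L M) = normal_part p g M"
  obtains c where "c \<ge> 0" "\<And>v w. v \<in> V \<Longrightarrow> w \<in> V \<Longrightarrow> rank (normal_part p g v) \<le> k \<Longrightarrow>
    rank (normal_part p g w) \<le> k \<Longrightarrow>
    lipschitz_joined {u \<in> V. rank (normal_part p g u) \<le> k} (c * dist v w) v w"
proof -
  let ?D = "normal_part p g"
  let ?W = "{u \<in> V. rank (?D u) \<le> k}"
  obtain b where b: "b \<ge> 0" "\<And>M. norm (L M) \<le> norm M * b"
    using bounded_linear.nonneg_bounded[OF L(1)] by blast
  obtain d where d: "d \<ge> 0" "\<And>M. norm (?D M) \<le> norm M * d"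
    using bounded_linear.nonneg_bounded[OF bounded_linear_normal_part] by blast
  define \<kappa> where "\<kappa> = real CARD('n) * real CARD('n)"
  \<comment> \<open>The outer 2 comes from concatenation. The segment to the midpoint
    \<open>z\<close> costs \<open>d * \<kappa> * b\<close> times the distance, and the triangle
    inequality charges it again, plus 1, for the second segment.\<close>
  define c where "c = 2 * (2 * (d * \<kappa> * b) + 1)"
  show ?thesis
  proof (rule that[of c])
    show "c \<ge> 0"
      using b d by (simp add: c_def \<kappa>_def)
    fix v w assume vw: "v \<in> V" "w \<in> V" "rank (?D v) \<le> k" "rank (?D w) \<le> k"
    define A where "A = ?D v"
    define B where "B = ?D w"
    obtain Q where Q: "B ** Q = 0" "\<And>x. B *v x = 0 \<Longrightarrow> Q *v x = x" "norm Q \<le> \<kappa>"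
      unfolding \<kappa>_def by (rule kernel_projection[OF adj, of B]) blast
    \<comment> \<open>The range of \<open>g\<close> lies in the kernel of \<open>B\<close>, so
      \<open>Q\<close> fixes it; hence \<open>A ** Q\<close> is again its own normal part.\<close>
    have "B ** g = 0"
      unfolding B_def by (rule normal_part_mult_0[OF p])
    then have "Q *v (g *v x) = g *v x" for x
      using Q(2)[of "g *v x"] by (simp add: matrix_vector_mul_assoc)
    then have Qg: "Q ** g = g"
      by (simp add: matrix_eq flip: matrix_vector_mul_assoc)
    have DAQ: "?D (A ** Q) = A ** Q"
    proof (rule normal_part_eqI)
      show "g ** (A ** Q) = 0"
        by (simp add: A_def matrix_mul_assoc normal_part_mult_0[OF p])
      have "A ** Q ** g = A ** (Q ** g)"
        by (simp add: matrix_mul_assoc)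
      then show "A ** Q ** g = 0"
        by (simp add: Qg A_def normal_part_mult_0[OF p])
    qed
    \<comment> \<open>The lift to \<open>V\<close> of the corner \<open>A ** (mat 1 - Q)\<close>,
      close to \<open>v\<close> because \<open>L\<close> is bounded.\<close>
    define z where "z = v - L (A ** Q)"
    have zV: "z \<in> V"
      unfolding z_def using V vw(1) L(2) by (rule subspace_diff)
    have Dz: "?D z = A - A ** Q"
      by (simp add: z_def normal_part_diff DL DAQ flip: A_def)
    have "closed_segment v z \<subseteq> ?W"
    proof
      fix u assume "u \<in> closed_segment v z"
      then obtain t where u: "u = (1 - t) *\<^sub>R v + t *\<^sub>R z"
        by (auto simp: closed_segment_def)
      have "?D u = (1 - t) *\<^sub>R A + t *\<^sub>R (A - A ** Q)"
        by (simp add: u linear_add[OF linear_normal_part] normal_part_scaleR Dz A_def)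
      also have "\<dots> = A ** (mat 1 - t *\<^sub>R Q)"
        by (simp add: matrix_distribs matrix_mult.scaleR_right algebra_simps)
      finally have "rank (?D u) \<le> rank A"
        by (simp add: rank_matrix_mult_le_left)
      moreover have "u \<in> V"
        unfolding u using V vw zV by (intro subspace_add subspace_scale)
      ultimately show "u \<in> ?W"
        using vw(3) by (simp add: A_def)
    qed
    then have 1: "lipschitz_joined ?W (dist v z) v z"
      by (rule lipschitz_joined_segment)
    have "closed_segment z w \<subseteq> ?W"
    proof
      fix u assume "u \<in> closed_segment z w"
      then obtain t where u: "u = (1 - t) *\<^sub>R z + t *\<^sub>R w"
        by (auto simp: closed_segment_def)
      have Du: "?D u = (1 - t) *\<^sub>R (A ** (mat 1 - Q)) + t *\<^sub>R B"
        by (simp add: u linear_add[OF linear_normal_part] normal_part_scaleR Dz B_def matrix_distribs)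
      have "?D u *v x = 0" if x: "B *v x = 0" for x
      proof -
        have "(A ** (mat 1 - Q)) *v x = 0"
          using Q(2)[OF x] by (simp add: matrix_vector_mult_diff_rdistrib flip: matrix_vector_mul_assoc)
        moreover have "(r *\<^sub>R M) *v x = r *\<^sub>R (M *v x)" for r and M :: "'k^'n^'m"
          by (simp add: matrix_vector_mult_def vec_eq_iff scaleR_sum_right)
        ultimately show ?thesis
          by (simp add: Du matrix_vector_mult_add_rdistrib x)
      qed
      then have "rank (?D u) \<le> rank B"
        by (rule rank_le_of_ker_subset)
      moreover have "u \<in> V"
        unfolding u using V vw zV by (intro subspace_add subspace_scale)
      ultimately show "u \<in> ?W"
        using vw(4) by (simp add: B_def)
    qed
    then have 2: "lipschitz_joined ?W (dist z w) z w"
      by (rule lipschitz_joined_segment)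
    have "norm (A ** Q) = norm (?D (v - w) ** Q)"
      using Q(1) by (simp add: A_def B_def normal_part_diff matrix_mult.diff_left)
    also have "\<dots> \<le> norm (v - w) * d * \<kappa>"
      by (intro norm_matrix_mult_mono d Q)
    finally have "norm (A ** Q) * b \<le> norm (v - w) * d * \<kappa> * b"
      using b(1) by (rule mult_right_mono)
    with b(2)[of "A ** Q"] have vz: "dist v z \<le> d * \<kappa> * b * dist v w"
      by (simp add: z_def dist_norm mult_ac)
    have "dist z w \<le> dist v z + dist v w"
      by (metis dist_commute dist_triangle)
    then have "2 * (dist v z + dist z w) \<le> c * dist v w"
      using vz by (simp add: c_def algebra_simps)
    then show "lipschitz_joined ?W (c * dist v w) v w"
      by (rule lipschitz_joined_mono[OF lipschitz_joined_trans[OF 1 2] _ order_refl])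
  qed
qed

section \<open>Transversality\<close>

lemma has_derivative_0_of_quadratic:
  fixes q :: "'a::real_normed_vector \<Rightarrow> 'b::real_normed_vector"
  assumes "\<delta> > 0" "\<And>x. norm x \<le> \<delta> \<Longrightarrow> norm (q x) \<le> C * norm x * norm x" "C \<ge> 0"
  shows "(q has_derivative (\<lambda>_. 0)) (at 0)"
  unfolding has_derivative_at_alt
proof (intro conjI allI impI)
  have q0: "q 0 = 0"
    using assms(1) assms(2)[of 0] by simp
  fix e :: real assume "e > 0"
  show "\<exists>d>0. \<forall>y. norm (y - 0) < d \<longrightarrow> norm (q y - q 0 - 0) \<le> e * norm (y - 0)"
  \<comment> \<open>The denominator \<open>C + 1\<close> also covers \<open>C = 0\<close>.\<close>
  proof (intro exI[of _ "min \<delta> (e / (C + 1))"] conjI allI impI)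
    show "min \<delta> (e / (C + 1)) > 0"
      using \<open>e > 0\<close> assms by (simp add: add_nonneg_pos)
    fix y :: 'a assume y: "norm (y - 0) < min \<delta> (e / (C + 1))"
    have "C * norm y \<le> (C + 1) * (e / (C + 1))"
      using y assms(3) by (intro mult_mono) auto
    also have "\<dots> = e"
      using assms(3) by simp
    finally have "C * norm y * norm y \<le> e * norm y"
      by (rule mult_right_mono) simp
    moreover have "norm (q y) \<le> C * norm y * norm y"
      using y by (intro assms) simp
    ultimately show "norm (q y - q 0 - 0) \<le> e * norm (y - 0)"
      by (simp add: q0)
  qed
qed simp

text \<open>Along a curve of constant rank the Schur complement vanishes, so the normal part of the
  displacement equals \<open>q\<close> of it. The derivatives at 0 are the normal part of
  \<open>v\<close> and 0.\<close>

lemma normal_part_tangent_space: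
  fixes p :: "'k::{real_normed_field,euclidean_space}^'n^'m"
  assumes p: "p ** g ** p = p" "g ** p ** g = g"
    and v: "v \<in> tangent_space (rank_stratum (rank p)) p"
  shows "normal_part p g v = 0"
proof -
  let ?D = "normal_part p g"
  obtain q C \<delta> where \<delta>: "(\<delta>::real) > 0" and C: "C \<ge> 0" and q0: "q 0 = 0"
    and rank: "\<And>E. norm E \<le> \<delta> \<Longrightarrow> rank (p + E) = rank p + rank (?D E - q E)"
    and q: "\<And>E E' \<rho>. norm E \<le> \<rho> \<Longrightarrow> norm E' \<le> \<rho> \<Longrightarrow> \<rho> \<le> \<delta> \<Longrightarrow>
       norm (q E - q E') \<le> C * \<rho> * norm (E - E')"
    by (rule rank_near[OF p]) blast
  obtain \<epsilon> \<gamma> where \<epsilon>: "\<epsilon> > 0" and \<gamma>: "\<gamma> ` {-\<epsilon><..<\<epsilon>} \<subseteq> rank_stratum (rank p)" "\<gamma> 0 = p"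
    "(\<gamma> has_vector_derivative v) (at 0)"
    using v unfolding tangent_space_def by blast
  have der: "((\<lambda>t. \<gamma> t - p) has_vector_derivative v) (at 0)"
    using has_vector_derivative_diff_const[THEN iffD2, OF \<gamma>(3)] by simp
  have "(q has_derivative (\<lambda>_. 0)) (at 0)"
    using \<delta> q[of _ _ 0] q0 C by (intro has_derivative_0_of_quadratic[of \<delta> q C]) auto
  then have "(q has_derivative (\<lambda>_. 0)) (at (\<gamma> 0 - p))"
    by (simp add: \<gamma>)
  from diff_chain_at[OF der[unfolded has_vector_derivative_def] this]
  have 1: "((\<lambda>t. q (\<gamma> t - p)) has_vector_derivative 0) (at 0)"
    by (simp add: has_vector_derivative_def o_def)
  have 2: "((\<lambda>t. ?D (\<gamma> t - p)) has_vector_derivative ?D v) (at 0)"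
    by (rule bounded_linear.has_vector_derivative[OF bounded_linear_normal_part der])
  have "continuous (at 0) \<gamma>"
    using \<gamma>(3) by (rule has_vector_derivative_continuous)
  then obtain e where e: "e > 0" "\<And>t. dist t 0 < e \<Longrightarrow> dist (\<gamma> t) p < \<delta>"
    using \<delta> \<gamma>(2) unfolding continuous_at_eps_delta by metis
  have "((\<lambda>t. q (\<gamma> t - p)) has_vector_derivative ?D v) (at 0)"
  proof (rule has_vector_derivative_transform_within_open[OF 2])
    show "open ({-\<epsilon><..<\<epsilon>} \<inter> ball 0 e)" "0 \<in> {-\<epsilon><..<\<epsilon>} \<inter> ball 0 e"
      using \<epsilon> e by auto
    fix t assume t: "t \<in> {-\<epsilon><..<\<epsilon>} \<inter> ball 0 e"
    then have "dist t 0 < e"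
      by (auto simp: dist_real_def)
    then have "norm (\<gamma> t - p) \<le> \<delta>"
      using e(2)[of t] by (simp add: dist_norm)
    moreover have "rank (\<gamma> t) = rank p"
      using \<gamma>(1) t by (auto simp: rank_stratum_def image_subset_iff)
    ultimately have "rank (?D (\<gamma> t - p) - q (\<gamma> t - p)) = 0"
      using rank[of "\<gamma> t - p"] by simp
    then show "?D (\<gamma> t - p) = q (\<gamma> t - p)"
      by (simp only: rank_eq_0_iff right_minus_eq)
  qed
  with 1 show ?thesis
    by (metis vector_derivative_unique_at)
qed

text \<open>Tangent vectors have no normal part, so transversality makes the normal parts of
  \<open>V\<close> exhaust all normal parts. A linear section over them with values in
  \<open>V\<close>, composed with \<open>normal_part p g\<close>, is \<open>L\<close>.\<close>

lemma transverse_right_inverse: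
  fixes p :: "'k::{real_normed_field,euclidean_space}^'n^'m"
  assumes p: "p ** g ** p = p" "g ** p ** g = g"
    and V: "subspace V" "p \<in> V" and tr: "transverse V (rank_stratum (rank p))"
  obtains L where "bounded_linear L" "\<And>M. L M \<in> V"
    "\<And>M. normal_part p g (L M) = normal_part p g M"
proof -
  let ?D = "normal_part p g"
  have sum: "V + tangent_space (rank_stratum (rank p)) p = UNIV"
    using tr V(2) by (auto simp: transverse_def rank_stratum_def)
  have range: "?D M \<in> ?D ` V" for M
  proof -
    have "M \<in> V + tangent_space (rank_stratum (rank p)) p"
      by (simp add: sum)
    then obtain v t where vt: "v \<in> V" "t \<in> tangent_space (rank_stratum (rank p)) p" "M = v + t"
      by (rule set_plus_elim)
    then have "?D M = ?D v"
      using normal_part_tangent_space[OF p vt(2)] by (simp add: linear_add[OF linear_normal_part])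
    then show ?thesis
      using vt(1) by blast
  qed
  have "\<exists>h. h ` UNIV \<subseteq> V \<and> linear h \<and> (\<forall>M\<in>?D ` V. ?D (h M) = M)"
    using linear_normal_part V(1) by (rule real_vector.linear_exists_right_inverse_on)
  then obtain h where h: "\<And>M. h M \<in> V" "linear h" "\<And>M. M \<in> ?D ` V \<Longrightarrow> ?D (h M) = M"
    by blast
  show ?thesis
  proof (rule that[of "h \<circ> ?D"])
    show "bounded_linear (h \<circ> ?D)"
      using linear_compose[OF linear_normal_part h(2)] by (rule linear_conv_bounded_linear[THEN iffD1])
  qed (use h range in auto)
qed

section \<open>Local and global normal embedding\<close>

lemma locally_lipschitz_joined:
  fixes p :: "'k::{real_normed_field,euclidean_space}^'n^'m"
  assumes adj: "\<And>c::'k. \<exists>c'. \<forall>a b. (c * a) \<bullet> b = a \<bullet> (c' * b)"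
    and V: "subspace V" "p \<in> V" and tr: "transverse V (rank_stratum (rank p))"
    and r: "rank p \<le> r"
  defines "Y \<equiv> V \<inter> {M. rank M \<le> r}"
  shows "\<exists>\<delta>>0. \<exists>K. \<forall>x\<in>Y \<inter> cball p \<delta>. \<forall>y\<in>Y \<inter> cball p \<delta>. lipschitz_joined Y (K * dist x y) x y"
proof -
  obtain g where p: "p ** g ** p = p" "g ** p ** g = g"
    by (rule generalized_inverse_exists)
  let ?D = "normal_part p g"
  let ?W = "{u \<in> V. rank (?D u) \<le> r - rank p}"
  obtain L where L: "bounded_linear L" "\<And>M. L M \<in> V" "\<And>M. ?D (L M) = ?D M"
    by (rule transverse_right_inverse[OF p V tr]) blast
  obtain c where c: "c \<ge> 0" and joined: "\<And>v w. v \<in> ?W \<Longrightarrow> w \<in> ?W \<Longrightarrow>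
      lipschitz_joined ?W (c * dist v w) v w"
    by (rule bounded_rank_normal_part_joined[OF adj p V(1) L, of "r - rank p"]) blast
  obtain b where b: "b \<ge> 0" "\<And>M. norm (L M) \<le> norm M * b"
    using bounded_linear.nonneg_bounded[OF L(1)] by blast
  obtain q C \<delta> where \<delta>: "(\<delta>::real) > 0" and C: "C \<ge> 0" and q0: "q 0 = 0"
    and rank: "\<And>E. norm E \<le> \<delta> \<Longrightarrow> rank (p + E) = rank p + rank (?D E - q E)"
    and Dq: "\<And>E. ?D (q E) = q E"
    and q: "\<And>E E' \<rho>. norm E \<le> \<rho> \<Longrightarrow> norm E' \<le> \<rho> \<Longrightarrow> \<rho> \<le> \<delta> \<Longrightarrow>
       norm (q E - q E') \<le> C * \<rho> * norm (E - E')"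
    by (rule rank_near[OF p]) blast
  \<comment> \<open>Chosen so that \<open>L\<close> composed with \<open>q\<close> is 1/2-Lipschitz
    on the ball of radius \<open>\<rho>\<close>.\<close>
  define \<rho> where "\<rho> = min \<delta> (1 / (2 * (C * b + 1)))"
  have Cb: "C * b \<ge> 0"
    using C b by simp
  have \<rho>: "\<rho> > 0" "\<rho> \<le> \<delta>" "C * b * \<rho> \<le> 1/2"
  proof -
    show "\<rho> > 0" "\<rho> \<le> \<delta>"
      using \<delta> Cb by (auto simp: \<rho>_def)
    have "C * b * \<rho> \<le> (C * b + 1) * (1 / (2 * (C * b + 1)))"
      using Cb \<delta> by (intro mult_mono) (auto simp: \<rho>_def)
    also have "\<dots> = 1/2"
      using Cb by simp
    finally show "C * b * \<rho> \<le> 1/2" .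
  qed
  define f where "f = (\<lambda>E. L (q E))"
  have f0: "f 0 = 0"
    using linear_0[OF bounded_linear.linear[OF L(1)]] by (simp add: f_def q0)
  have f_lip: "(1/2)-lipschitz_on (cball 0 \<rho>) f"
  proof (rule lipschitz_onI)
    fix E E' :: "'k^'n^'m" assume E: "E \<in> cball 0 \<rho>" "E' \<in> cball 0 \<rho>"
    have "dist (f E) (f E') = norm (L (q E - q E'))"
      by (simp add: f_def dist_norm linear_diff[OF bounded_linear.linear[OF L(1)]])
    also have "\<dots> \<le> norm (q E - q E') * b"
      by (rule b)
    also have "\<dots> \<le> C * \<rho> * norm (E - E') * b"
      using E \<rho> b by (intro mult_right_mono q) auto
    also have "\<dots> = (C * b * \<rho>) * norm (E - E')"
      by (simp add: mult_ac)
    also have "\<dots> \<le> 1/2 * norm (E - E')"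
      using \<rho>(3) by (rule mult_right_mono) simp
    finally show "dist (f E) (f E') \<le> 1/2 * dist E E'"
      by (simp add: dist_norm)
  qed simp
  obtain \<psi> where \<psi>_lip: "2-lipschitz_on (cball 0 (\<rho> / 2)) \<psi>"
    and \<psi>: "\<And>w. w \<in> cball 0 (\<rho> / 2) \<Longrightarrow> \<psi> w \<in> cball 0 \<rho> \<and> \<psi> w - f (\<psi> w) = w"
    and \<psi>_eq: "\<And>x. x \<in> cball 0 \<rho> \<Longrightarrow> x - f x \<in> cball 0 (\<rho> / 2) \<Longrightarrow> \<psi> (x - f x) = x"
    using perturbed_identity_inverse[OF less_imp_le[OF \<rho>(1)] f0 f_lip] by blast
  have D_f: "?D (E - f E) = ?D E - q E" for E
    by (simp add: f_def normal_part_diff L(3) Dq)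
  \<comment> \<open>The natural-number subtraction is exact because
    \<open>rank p \<le> r\<close>.\<close>
  have rank_iff: "rank (p + E) \<le> r \<longleftrightarrow> rank (?D (E - f E)) \<le> r - rank p" if "E \<in> cball 0 \<rho>" for E
    using rank[of E] that \<rho> r unfolding D_f by auto
  have V_iff: "p + E \<in> V \<longleftrightarrow> E - f E \<in> V" for E
  proof -
    have "f E \<in> V"
      by (simp add: f_def L(2))
    then show ?thesis
      using V by (metis add_diff_cancel_left' diff_add_cancel subspace_add subspace_diff)
  qed
  \<comment> \<open>A path in the chart starts within \<open>2 * \<eta>\<close> of 0 and has length
    at most \<open>c * (4 * \<eta>)\<close>; this choice keeps it in the ball where
    \<open>\<psi>\<close> is defined.\<close>
  define \<eta> where "\<eta> = \<rho> / (4 * (1 + 2 * c))"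
  have \<eta>: "\<eta> > 0" "2 * \<eta> + c * (4 * \<eta>) \<le> \<rho> / 2" "\<eta> \<le> \<rho>"
  proof -
    show "\<eta> > 0"
      using \<rho>(1) c by (simp add: \<eta>_def)
    have "4 * (1 + 2 * c) * \<eta> = \<rho>"
      using c by (simp add: \<eta>_def)
    then show "2 * \<eta> + c * (4 * \<eta>) \<le> \<rho> / 2"
      by (simp add: algebra_simps)
    moreover have "c * (4 * \<eta>) \<ge> 0"
      using c \<open>\<eta> > 0\<close> by simp
    ultimately show "\<eta> \<le> \<rho>"
      using \<open>\<eta> > 0\<close> by linarith
  qed
  define Z where "Z = ?W \<inter> cball 0 (\<rho> / 2)"
  have chart_lip: "2-lipschitz_on Z (\<lambda>w. p + \<psi> w)"
  proof (rule lipschitz_onI)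
    fix v w assume "v \<in> Z" "w \<in> Z"
    then show "dist (p + \<psi> v) (p + \<psi> w) \<le> 2 * dist v w"
      using lipschitz_onD[OF \<psi>_lip, of v w] by (simp add: Z_def)
  qed simp
  have chart_into: "(\<lambda>w. p + \<psi> w) ` Z \<subseteq> Y"
  proof safe
    fix w assume "w \<in> Z"
    then show "p + \<psi> w \<in> Y"
      using \<psi>[of w] rank_iff[of "\<psi> w"] V_iff[of "\<psi> w"] by (auto simp: Y_def Z_def)
  qed
  have "lipschitz_joined Y (4 * c * dist x y) x y" if x: "x \<in> Y \<inter> cball p \<eta>" and y: "y \<in> Y \<inter> cball p \<eta>" for x y
  proof -
    define v where "v = (x - p) - f (x - p)"
    define w where "w = (y - p) - f (y - p)"
    have small: "norm (x - p) \<le> \<eta>" "norm (y - p) \<le> \<eta>"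
      using x y by (auto simp: dist_norm norm_minus_commute)
    have in_cball: "x - p \<in> cball 0 \<rho>" "y - p \<in> cball 0 \<rho>"
      using small \<eta>(3) by auto
    have "v \<in> ?W" "w \<in> ?W"
      using x y rank_iff[OF in_cball(1)] rank_iff[OF in_cball(2)] V_iff[of "x - p"] V_iff[of "y - p"]
      by (auto simp: Y_def v_def w_def)
    then have vw_joined: "lipschitz_joined ?W (c * dist v w) v w"
      by (rule joined)
    have f_half: "norm (f E) \<le> 1/2 * norm E" if "E \<in> cball 0 \<rho>" for E
      using lipschitz_onD[OF f_lip that, of 0] f0 \<rho>(1) by simp
    have "norm (f (x - p) - f (y - p)) \<le> 1/2 * dist x y"
      using lipschitz_onD[OF f_lip in_cball] by (simp add: dist_norm)
    moreover have "v - w = (x - y) - (f (x - p) - f (y - p))"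
      by (simp add: v_def w_def)
    then have "norm (v - w) \<le> norm (x - y) + norm (f (x - p) - f (y - p))"
      by (metis norm_triangle_ineq4)
    ultimately have dvw: "dist v w \<le> 2 * dist x y"
      unfolding dist_norm using norm_ge_zero[of "x - y"] by linarith
    have nv: "norm v \<le> 2 * \<eta>" and nw: "norm w \<le> 2 * \<eta>"
      using norm_triangle_ineq4[of "x - p" "f (x - p)"] f_half[OF in_cball(1)]
        norm_triangle_ineq4[of "y - p" "f (y - p)"] f_half[OF in_cball(2)] small \<eta>(1)
      unfolding v_def w_def by linarith+
    have "2 * \<eta> \<le> \<rho> / 2"
      using \<eta>(1,2) c by (smt (verit) mult_nonneg_nonneg)
    then have "v \<in> cball 0 (\<rho> / 2)" "w \<in> cball 0 (\<rho> / 2)"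
      using nv nw by simp_all
    then have \<psi>_vw: "\<psi> v = x - p" "\<psi> w = y - p"
      using \<psi>_eq in_cball unfolding v_def w_def by blast+
    have "dist x y \<le> 2 * \<eta>"
      using x y dist_triangle2[of x y p] by (auto simp: dist_commute)
    then have cvw: "c * dist v w \<le> c * (4 * \<eta>)"
      using dvw c by (intro mult_left_mono) auto
    have "lipschitz_joined Z (c * dist v w) v w"
    proof -
      obtain h :: "real \<Rightarrow> 'k^'n^'m" where h: "(c * dist v w)-lipschitz_on {0..1} h" "h ` {0..1} \<subseteq> ?W"
        "h 0 = v" "h 1 = w"
        using vw_joined by (rule lipschitz_joinedE)
      have "norm (h t) \<le> \<rho> / 2" if "t \<in> {0..1}" for t
      proof -
        have "dist (h 0) (h t) \<le> c * dist v w * dist 0 t"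
          using that by (intro lipschitz_onD[OF h(1)]) auto
        also have "\<dots> \<le> c * dist v w * 1"
          using that c by (intro mult_left_mono) (auto simp: dist_real_def)
        finally have "norm (h t) \<le> norm v + c * dist v w"
          using norm_triangle_sub[of "h t" v] by (simp add: h(3) dist_norm norm_minus_commute)
        then show ?thesis
          using nv cvw \<eta>(2) by linarith
      qed
      then have "h ` {0..1} \<subseteq> Z"
        using h(2) by (auto simp: Z_def)
      then show ?thesis
        unfolding lipschitz_joined_def using h by blast
    qed
    from lipschitz_joined_image[OF this chart_lip chart_into]
    have "lipschitz_joined Y (2 * (c * dist v w)) (p + \<psi> v) (p + \<psi> w)" .
    then have "lipschitz_joined Y (2 * (c * dist v w)) x y"
      by (simp add: \<psi>_vw)
    \<comment> \<open>One factor 2 comes from the Lipschitz constant of \<open>\<psi>\<close>, the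
      other from \<open>dvw\<close>.\<close>
    moreover have "2 * (c * dist v w) \<le> 4 * c * dist x y"
      using mult_left_mono[OF dvw c] by simp
    ultimately show ?thesis
      using lipschitz_joined_mono order_refl by metis
  qed
  then show ?thesis
    using \<eta>(1) by blast
qed

lemma transverse_lipschitz_normally_embedded:
  fixes V :: "('k::{real_normed_field,euclidean_space}^'n^'m) set"
  assumes adj: "\<And>c::'k. \<exists>c'. \<forall>a b. (c * a) \<bullet> b = a \<bullet> (c' * b)"
    and V: "mat_space.subspace V"
    and tr: "\<And>s. s \<noteq> 0 \<Longrightarrow> transverse V (rank_stratum s)"
  shows "lipschitz_normally_embedded (V \<inter> closure (rank_stratum r))"
proof (cases "r \<le> CARD('m) \<and> r \<le> CARD('n)")
  case False
  \<comment> \<open>For \<open>r\<close> beyond the matrix size the stratum itself is empty, so its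
    closure is empty rather than the whole space.\<close>
  then have "rank_stratum r = ({} :: ('k^'n^'m) set)"
    using rank_le_CARD by (fastforce simp: rank_stratum_def)
  then show ?thesis
    by (auto simp: lipschitz_normally_embedded_def)
next
  case True
  have scaleR: "c *\<^sub>R M = mat_scale (of_real c) M" for c and M :: "'k^'n^'m"
    by (simp add: mat_scale_def vec_eq_iff scaleR_conv_of_real[where 'a = 'k])
  have sub: "subspace V"
    using V unfolding subspace_def mat_space.subspace_def scaleR by blast
  have eq: "closure (rank_stratum r) = {M :: 'k^'n^'m. rank M \<le> r}"
    using True by (intro closure_rank_stratum) auto
  show ?thesis
  proof (rule lipschitz_normally_embedded_cone)
    show "closed (V \<inter> closure (rank_stratum r))"
      using sub by (intro closed_Int closed_subspace closed_closure)
    fix c :: real and x assume "x \<in> V \<inter> closure (rank_stratum r)"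
    moreover have "rank (c *\<^sub>R x) \<le> rank x"
    proof -
      have "c *\<^sub>R x = (c *\<^sub>R mat 1) ** x"
        by (simp add: matrix_mult.scaleR_left)
      then show ?thesis
        by (metis rank_matrix_mult_le_right)
    qed
    ultimately show "c *\<^sub>R x \<in> V \<inter> closure (rank_stratum r)"
      using sub by (auto simp: eq subspace_scale)
  next
    fix p assume p: "p \<in> V \<inter> closure (rank_stratum r)" "p \<noteq> 0"
    \<comment> \<open>A nonzero matrix has nonzero rank, so transversality is available exactly
      where the cone criterion asks for a local bound.\<close>
    then have "transverse V (rank_stratum (rank p))"
      by (intro tr) (simp add: rank_eq_0_iff)
    then show "\<exists>\<delta>>0. \<exists>K. \<forall>x\<in>V \<inter> closure (rank_stratum r) \<inter> cball p \<delta>.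
        \<forall>y\<in>V \<inter> closure (rank_stratum r) \<inter> cball p \<delta>.
          lipschitz_joined (V \<inter> closure (rank_stratum r)) (K * dist x y) x y"
      using p(1) unfolding eq by (intro locally_lipschitz_joined[OF adj sub]) auto
  qed
qed

theorem proposition4p4:
  shows "(\<forall>V :: (real^'n^'m) set.
            mat_space.subspace V \<longrightarrow>
            (\<forall>s. s \<noteq> 0 \<longrightarrow> transverse V (rank_stratum s)) \<longrightarrow>
            (\<forall>r. lipschitz_normally_embedded (V \<inter> closure (rank_stratum r))))
       \<and> (\<forall>V :: (complex^'n^'m) set.
            mat_space.subspace V \<longrightarrow>
            (\<forall>s. s \<noteq> 0 \<longrightarrow> transverse V (rank_stratum s)) \<longrightarrow>
            (\<forall>r. lipschitz_normally_embedded (V \<inter> closure (rank_stratum r))))"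
proof (intro conjI allI impI transverse_lipschitz_normally_embedded)
  show "\<exists>c'. \<forall>a b. (c * a) \<bullet> b = a \<bullet> (c' * b)" for c :: real
    by (intro exI[of _ c]) simp
  \<comment> \<open>The real inner product on the complex numbers is the real part of
    \<open>a * cnj b\<close>, so multiplication by \<open>c\<close> has adjoint multiplication by
    \<open>cnj c\<close>.\<close>
  show "\<exists>c'. \<forall>a b. (c * a) \<bullet> b = a \<bullet> (c' * b)" for c :: complex
    by (intro exI[of _ "cnj c"]) (simp add: inner_complex_def algebra_simps)
qed auto

end
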